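(* Let $r>1$ be an integer with $r\not\equiv 0 \pmod 4$, let $m\in\mathbb{N}$, and let $\widehat{\mathfrak{spin}(r)}=\mathfrak{spin}(r)\otimes\{\mathrm{Id}_{m\times m}\}\subset\mathfrak{so}(d_rm)$ be the image of $\mathfrak{spin}(r)$ acting on $\mathbb{R}^{d_rm}=\tilde\Delta_r\otimes_{\mathbb{R}}\mathbb{R}^m$ through the first factor. Then the centralizer $C_{\mathfrak{so}(d_rm)}(\widehat{\mathfrak{spin}(r)})$ of $\widehat{\mathfrak{spin}(r)}$ in $\mathfrak{so}(d_rm)$ is isomorphic, as a Lie algebra, to \begin{itemize} \item $\mathfrak{so}(m)$ if $r\equiv 1$ or $7 \pmod 8$; \item $\mathfrak{u}(m)$ if $r\equiv 2$ or $6 \pmod 8$; \item $\mathfrak{sp}(m)$ if $r\equiv 3$ or $5 \pmod 8$. \end{itemize}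
   Context: $Cl_r$ is the real Clifford algebra generated by an orthonormal basis $e_1,\dots,e_r$ of $\mathbb{R}^r$ (standard positive definite inner product) subject to $e_je_k+e_ke_j=-2\delta_{jk}$, and $Cl_r^0$ is its even subalgebra. $\mathfrak{spin}(r)=\mathrm{span}\{e_ie_j \mid 1\le i<j\le r\}\subset Cl_r^0$ with the commutator bracket. For $r\not\equiv 0\pmod 4$, $Cl_r^0$ has, up to isomorphism, exactly one irreducible real representation, denoted $\tilde\Delta_r$, of real dimension $d_r$, where $d_r=2^{\lfloor r/2\rfloor}$ if $r\equiv 1,2,6,7\pmod 8$ and $d_r=2^{\lfloor r/2\rfloor+1}$ if $r\equiv 3,5\pmod 8$. It is endowed with an inner product for which each $e_ie_j$ ($i<j$) acts as an antisymmetric endomorphism (squaring to $-\mathrm{Id}$), so that $\mathfrak{spin}(r)$ acts on $\tilde\Delta_r\cong\mathbb{R}^{d_r}$ through $\mathfrak{so}(d_r)$. The space $\tilde\Delta_r\otimes\mathbb{R}^m\cong\mathbb{R}^{d_rm}$ (the sum of $m$ copies of $\tilde\Delta_r$) carries the tensor product inner product, with the standard one on $\mathbb{R}^m$; an element $A\in\mathfrak{spin}(r)$ acts as $A\otimes\mathrm{Id}_{m\times m}$. $\mathfrak{so}(m)$, $\mathfrak{u}(m)$, $\mathfrak{sp}(m)$ denote the real Lie algebras of $m\times m$ real antisymmetric, complex anti-Hermitian and quaternionic anti-Hermitian matrices respectively (all compact forms). $C_{\mathfrak{g}}(\mathfrak{k})=\{X\in\mathfrak{g}\mid [X,Y]=0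 \ \forall\, Y\in\mathfrak{k}\}$. *)

theory Defs
  imports "HOL-Analysis.Analysis"
begin

section \<open>The real Clifford algebra of a negative definite form\<close>

text \<open>
  An element is a finite linear combination of basis blades
  \<open>e\<^bsub>a1\<^esub> \<dots> e\<^bsub>ak\<^esub>\<close> with \<open>a1 < \<dots> < ak\<close>, indexed by the
  finite set \<open>{a1, \<dots>, ak}\<close>. The type has one generator for every natural number;
  the algebra with \<open>r\<close> generators is the subalgebra \<open>Cl r\<close> below. The lemmas
  \<open>cl_e_anticommute\<close> and \<open>Cl_universal\<close> show that \<open>Cl r\<close> is the algebra presented by
  \<open>cl_e 1, \<dots>, cl_e r\<close> and the Clifford relations.
\<close>

typedef clifford =
  "{f :: nat set \<Rightarrow> real. finite {A. f A \<noteq> 0} \<and> (\<forall>A. f A \<noteq> 0 \<longrightarrow> finite A)}"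
  morphisms cl_coeff Abs_clifford
  by (rule exI[of _ "\<lambda>_. 0"]) simp

lemma cl_finite_supp: "finite {A. cl_coeff u A \<noteq> 0}"
  and cl_supp_finite: "cl_coeff u A \<noteq> 0 \<Longrightarrow> finite A"
  using cl_coeff[of u] by auto

lemma cl_eqI: "(\<And>A. cl_coeff u A = cl_coeff v A) \<Longrightarrow> u = v"
  by (metis cl_coeff_inject ext)

definition symd :: "'a set \<Rightarrow> 'a set \<Rightarrow> 'a set" where
  "symd A B = (A - B) \<union> (B - A)"

lemma symd_comm: "symd A B = symd B A"
  and symd_assoc: "symd (symd A B) C = symd A (symd B C)"
  and symd_self [simp]: "symd A A = {}"
  and symd_cancel [simp]: "symd A (symd A B) = B"
  and symd_empty [simp]: "symd {} A = A" "symd A {} = A"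
  by (auto simp: symd_def)

lemma finite_symd [simp]: "finite A \<Longrightarrow> finite B \<Longrightarrow> finite (symd A B)"
  by (simp add: symd_def)

text \<open>
  Sorting \<open>e\<^bsub>A\<^esub> e\<^bsub>B\<^esub>\<close> costs one sign for each pair with \<open>b < a\<close>,
  and each common index contributes \<open>e\<^bsub>a\<^esub> e\<^bsub>a\<^esub> = -1\<close>.
\<close>

definition cl_sign :: "nat set \<Rightarrow> nat set \<Rightarrow> real" where
  "cl_sign A B = (-1) ^ card {(a, b). a \<in> A \<and> b \<in> B \<and> b \<le> a}"

lemma minus_one_card_symd:
  assumes "finite X" "finite Y"
  shows "(-1::real) ^ card (symd X Y) = (-1) ^ card X * (-1) ^ card Y"
proof -
  have 1: "card X = card (X - Y) + card (X \<inter> Y)"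
    using assms by (metis card_Diff_subset_Int card_mono finite_Int inf_le1 le_add_diff_inverse2)
  have 2: "card Y = card (Y - X) + card (X \<inter> Y)"
    using assms by (metis Int_commute card_Diff_subset_Int card_mono finite_Int inf_le1 le_add_diff_inverse2)
  have 3: "card (symd X Y) = card (X - Y) + card (Y - X)"
    unfolding symd_def using assms by (intro card_Un_disjoint) auto
  show ?thesis by (simp add: 1 2 3 power_add flip: power_mult_distrib)
qed

lemma finite_inversions: "finite A \<Longrightarrow> finite B \<Longrightarrow> finite {(a, b). a \<in> A \<and> b \<in> B \<and> P a b}"
  by (rule finite_subset[of _ "A \<times> B"]) auto

lemma cl_sign_symd_left:
  assumes "finite A" "finite A'" "finite B"
  shows "cl_sign (symd A A') B = cl_sign A B * cl_sign A' B"
proof -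
  have "{(a, b). a \<in> symd A A' \<and> b \<in> B \<and> b \<le> a}
    = symd {(a, b). a \<in> A \<and> b \<in> B \<and> b \<le> a} {(a, b). a \<in> A' \<and> b \<in> B \<and> b \<le> a}"
    by (auto simp: symd_def)
  then show ?thesis
    unfolding cl_sign_def by (simp add: minus_one_card_symd finite_inversions assms)
qed

lemma cl_sign_symd_right:
  assumes "finite A" "finite B" "finite B'"
  shows "cl_sign A (symd B B') = cl_sign A B * cl_sign A B'"
proof -
  have "{(a, b). a \<in> A \<and> b \<in> symd B B' \<and> b \<le> a}
    = symd {(a, b). a \<in> A \<and> b \<in> B \<and> b \<le> a} {(a, b). a \<in> A \<and> b \<in> B' \<and> b \<le> a}"
    by (auto simp: symd_def)
  then show ?thesis
    unfolding cl_sign_def by (simp add: minus_one_card_symd finite_inversions assms)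
qed

lemma cl_sign_empty [simp]: "cl_sign {} B = 1" "cl_sign A {} = 1"
  by (simp_all add: cl_sign_def)

lemma cl_sign_less:
  assumes "\<And>a b. a \<in> A \<Longrightarrow> b \<in> B \<Longrightarrow> a < b"
  shows "cl_sign A B = 1"
proof -
  have "{(a, b). a \<in> A \<and> b \<in> B \<and> b \<le> a} = {}"
    using assms by fastforce
  then show ?thesis unfolding cl_sign_def by (metis card.empty power_0)
qed

lemma cl_sign_singleton: "cl_sign {a} {b} = (if b \<le> a then -1 else 1)"
proof -
  have "{(a', b'). a' \<in> {a} \<and> b' \<in> {b} \<and> b' \<le> a'} = (if b \<le> a then {(a, b)} else {})"
    by auto
  then show ?thesis by (simp add: cl_sign_def)
qed

definition blade :: "nat set \<Rightarrow> clifford" where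
  "blade A = Abs_clifford (\<lambda>B. if B = A \<and> finite A then 1 else 0)"

lemma coeff_blade: "cl_coeff (blade A) B = (if B = A \<and> finite A then 1 else 0)"
  unfolding blade_def by (subst Abs_clifford_inverse) auto

instantiation clifford :: real_vector
begin

definition "0 = Abs_clifford (\<lambda>_. 0)"
definition "u + v = Abs_clifford (\<lambda>A. cl_coeff u A + cl_coeff v A)"
definition "- u = Abs_clifford (\<lambda>A. - cl_coeff u A)"
definition "u - v = Abs_clifford (\<lambda>A. cl_coeff u A - cl_coeff v A)"
definition "c *\<^sub>R u = Abs_clifford (\<lambda>A. c * cl_coeff u A)"

lemma coeff_0 [simp]: "cl_coeff 0 A = 0"
  unfolding zero_clifford_def by (subst Abs_clifford_inverse) auto

lemma coeff_add [simp]: "cl_coeff (u + v) A = cl_coeff u A + cl_coeff v A"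
proof -
  have "finite {A. cl_coeff u A + cl_coeff v A \<noteq> 0}"
    by (rule finite_subset[of _ "{A. cl_coeff u A \<noteq> 0} \<union> {A. cl_coeff v A \<noteq> 0}"])
      (auto simp: cl_finite_supp)
  moreover have "finite A" if "cl_coeff u A + cl_coeff v A \<noteq> 0" for A
    using that cl_supp_finite by (metis add_0)
  ultimately show ?thesis
    unfolding plus_clifford_def by (subst Abs_clifford_inverse) auto
qed

lemma coeff_scaleR [simp]: "cl_coeff (c *\<^sub>R u) A = c * cl_coeff u A"
proof -
  have "finite {A. c * cl_coeff u A \<noteq> 0}"
    by (rule finite_subset[OF _ cl_finite_supp[of u]]) auto
  then show ?thesis
    unfolding scaleR_clifford_def by (subst Abs_clifford_inverse) (auto intro: cl_supp_finite)
qed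

lemma coeff_uminus [simp]: "cl_coeff (- u) A = - cl_coeff u A"
  unfolding uminus_clifford_def using cl_finite_supp[of u]
  by (subst Abs_clifford_inverse) (auto intro: cl_supp_finite)

lemma coeff_diff [simp]: "cl_coeff (u - v) A = cl_coeff u A - cl_coeff v A"
proof -
  have "u - v = u + - v"
    unfolding minus_clifford_def plus_clifford_def by simp
  then show ?thesis by simp
qed

instance
  by standard (auto intro!: cl_eqI simp: algebra_simps)

end

lemma coeff_sum: "cl_coeff (sum f S) A = (\<Sum>x\<in>S. cl_coeff (f x) A)"
  by (induction S rule: infinite_finite_induct) auto

definition cl_times_coeff :: "clifford \<Rightarrow> clifford \<Rightarrow> nat set \<Rightarrow> real" where
  "cl_times_coeff u v C =
     (\<Sum>A | cl_coeff u A \<noteq> 0. cl_sign A (symd A C) * cl_coeff u A * cl_coeff v (symd A C))"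

lemma cl_times_coeff_superset:
  assumes "finite S" "{A. cl_coeff u A \<noteq> 0} \<subseteq> S"
  shows "cl_times_coeff u v C =
     (\<Sum>A\<in>S. cl_sign A (symd A C) * cl_coeff u A * cl_coeff v (symd A C))"
  unfolding cl_times_coeff_def using assms by (intro sum.mono_neutral_left) auto

lemma cl_times_coeff_nonzero:
  assumes "cl_times_coeff u v C \<noteq> 0"
  shows "\<exists>A B. cl_coeff u A \<noteq> 0 \<and> cl_coeff v B \<noteq> 0 \<and> C = symd A B"
proof -
  obtain A where "cl_coeff u A \<noteq> 0"
      "cl_sign A (symd A C) * cl_coeff u A * cl_coeff v (symd A C) \<noteq> 0"
    using assms unfolding cl_times_coeff_def by (metis (mono_tags, lifting) sum.neutral mem_Collect_eq)
  then show ?thesis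
    by (intro exI[of _ A] exI[of _ "symd A C"]) auto
qed

lemma cl_common_support:
  "\<exists>N. finite N \<and> {A. cl_coeff u A \<noteq> 0} \<subseteq> Pow N"
  by (rule exI[of _ "\<Union>{A. cl_coeff u A \<noteq> 0}"]) (auto simp: cl_finite_supp intro: cl_supp_finite)

lemma symd_subset: "A \<subseteq> N \<Longrightarrow> B \<subseteq> N \<Longrightarrow> symd A B \<subseteq> N"
  by (auto simp: symd_def)

instantiation clifford :: real_algebra_1
begin

definition "1 = blade {}"
definition "u * v = Abs_clifford (cl_times_coeff u v)"

lemma coeff_one: "cl_coeff 1 A = (if A = {} then 1 else 0)"
  by (simp add: one_clifford_def coeff_blade)

lemma coeff_times: "cl_coeff (u * v) C = cl_times_coeff u v C"
proof -
  have "finite {C. cl_times_coeff u v C \<noteq> 0}"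
    by (rule finite_subset[of _ "(\<lambda>(A, B). symd A B) ` ({A. cl_coeff u A \<noteq> 0} \<times> {A. cl_coeff v A \<noteq> 0})"])
      (use cl_times_coeff_nonzero in \<open>force simp: cl_finite_supp\<close>)+
  moreover have "finite C" if "cl_times_coeff u v C \<noteq> 0" for C
    using cl_times_coeff_nonzero[OF that] cl_supp_finite by auto
  ultimately show ?thesis
    unfolding times_clifford_def by (subst Abs_clifford_inverse) auto
qed

instance
proof
  fix u v w :: clifford and c :: real
  obtain Nu Nv where N: "finite Nu" "{A. cl_coeff u A \<noteq> 0} \<subseteq> Pow Nu"
      "finite Nv" "{A. cl_coeff v A \<noteq> 0} \<subseteq> Pow Nv"
    using cl_common_support by metis
  define N where "N = Nu \<union> Nv"
  have fN: "finite (Pow N)" "finite N" using N by (auto simp: N_def)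
  have su: "{A. cl_coeff u A \<noteq> 0} \<subseteq> Pow N" and sv: "{A. cl_coeff v A \<noteq> 0} \<subseteq> Pow N"
    using N by (auto simp: N_def)
  have suv: "{A. cl_coeff (u * v) A \<noteq> 0} \<subseteq> Pow N"
  proof
    fix C assume "C \<in> {A. cl_coeff (u * v) A \<noteq> 0}"
    then obtain A B where "cl_coeff u A \<noteq> 0" "cl_coeff v B \<noteq> 0" "C = symd A B"
      using cl_times_coeff_nonzero[of u v C] by (auto simp: coeff_times)
    then have "A \<subseteq> N" "B \<subseteq> N" "C = symd A B"
      using su sv by auto
    then show "C \<in> Pow N"
      using symd_subset[of A N B] by simp
  qed
  show "u * v * w = u * (v * w)"
  proof (rule cl_eqI)
    fix D
    let ?s = cl_sign and ?u = "cl_coeff u" and ?v = "cl_coeff v" and ?w = "cl_coeff w"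
    have key: "?s (symd A B) (symd (symd A B) D) * (?s A B * ?u A * ?v B) * ?w (symd (symd A B) D)
        = ?s A (symd A D) * ?u A * (?s B (symd B (symd A D)) * ?v B * ?w (symd B (symd A D)))"
      if "A \<in> Pow N" "B \<in> Pow N" for A B
    proof -
      have fin: "finite A" "finite B"
        using fN(2) that by (auto intro: finite_subset)
      define E where "E = symd B (symd A D)"
      have E: "symd (symd A B) D = E"
        unfolding E_def by (subst symd_comm[of A B]) (rule symd_assoc)
      have E': "symd A D = symd B E"
        unfolding E_def by (rule symd_cancel[symmetric])
      have "?s (symd A B) E * ?s A B * ?w E = ?s A (symd B E) * ?s B E * ?w E"
      proof (cases "?w E = 0")
        case False
        then have "finite E" by (rule cl_supp_finite)
        then show ?thesis
          using fin by (simp add: cl_sign_symd_left cl_sign_symd_right)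
      qed simp
      then show ?thesis
        unfolding E E_def[symmetric] unfolding E' by (simp add: mult_ac)
    qed
    have "cl_coeff (u * v * w) D =
        (\<Sum>C\<in>Pow N. ?s C (symd C D) * cl_coeff (u * v) C * ?w (symd C D))"
      by (subst coeff_times, subst cl_times_coeff_superset[OF fN(1) suv]) simp
    also have "\<dots> = (\<Sum>C\<in>Pow N. \<Sum>A\<in>Pow N.
        ?s C (symd C D) * (?s A (symd A C) * ?u A * ?v (symd A C)) * ?w (symd C D))"
      by (simp add: coeff_times cl_times_coeff_superset[OF fN(1) su] sum_distrib_left sum_distrib_right)
    also have "\<dots> = (\<Sum>A\<in>Pow N. \<Sum>C\<in>Pow N.
        ?s C (symd C D) * (?s A (symd A C) * ?u A * ?v (symd A C)) * ?w (symd C D))"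
      by (rule sum.swap)
    also have "\<dots> = (\<Sum>A\<in>Pow N. \<Sum>B\<in>Pow N.
        ?s (symd A B) (symd (symd A B) D) * (?s A B * ?u A * ?v B) * ?w (symd (symd A B) D))"
    proof (rule sum.cong[OF refl])
      fix A assume A: "A \<in> Pow N"
      show "(\<Sum>C\<in>Pow N.
          ?s C (symd C D) * (?s A (symd A C) * ?u A * ?v (symd A C)) * ?w (symd C D))
        = (\<Sum>B\<in>Pow N.
          ?s (symd A B) (symd (symd A B) D) * (?s A B * ?u A * ?v B) * ?w (symd (symd A B) D))"
        by (rule sum.reindex_bij_witness[of _ "symd A" "symd A"])
          (use A in \<open>simp_all add: symd_subset\<close>)
    qed
    also have "\<dots> = (\<Sum>A\<in>Pow N. \<Sum>B\<in>Pow N.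
        ?s A (symd A D) * ?u A * (?s B (symd B (symd A D)) * ?v B * ?w (symd B (symd A D))))"
      by (intro sum.cong refl key)
    also have "\<dots> = (\<Sum>A\<in>Pow N. ?s A (symd A D) * ?u A * cl_coeff (v * w) (symd A D))"
      by (simp add: coeff_times cl_times_coeff_superset[OF fN(1) sv] sum_distrib_left)
    also have "\<dots> = cl_coeff (u * (v * w)) D"
      by (subst coeff_times, subst cl_times_coeff_superset[OF fN(1) su]) simp
    finally show "cl_coeff (u * v * w) D = cl_coeff (u * (v * w)) D" .
  qed
  have suv': "{A. cl_coeff (u + v) A \<noteq> 0} \<subseteq> Pow N"
  proof
    fix A assume "A \<in> {A. cl_coeff (u + v) A \<noteq> 0}"
    then have "cl_coeff u A \<noteq> 0 \<or> cl_coeff v A \<noteq> 0" by auto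
    then show "A \<in> Pow N" using su sv by blast
  qed
  show "(u + v) * w = u * w + v * w"
    by (rule cl_eqI)
      (simp add: coeff_times cl_times_coeff_superset[OF fN(1) su]
        cl_times_coeff_superset[OF fN(1) sv] cl_times_coeff_superset[OF fN(1) suv']
        algebra_simps flip: sum.distrib)
  show "w * (u + v) = w * u + w * v"
    by (rule cl_eqI) (simp add: coeff_times cl_times_coeff_def algebra_simps flip: sum.distrib)
  have scu: "{A. cl_coeff (c *\<^sub>R u) A \<noteq> 0} \<subseteq> Pow N"
    using su by auto
  show "c *\<^sub>R u * v = c *\<^sub>R (u * v)"
    by (rule cl_eqI)
      (simp add: coeff_times cl_times_coeff_superset[OF fN(1) su]
        cl_times_coeff_superset[OF fN(1) scu] sum_distrib_left algebra_simps)
  show "u * c *\<^sub>R v = c *\<^sub>R (u * v)"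
    by (rule cl_eqI) (simp add: coeff_times cl_times_coeff_def sum_distrib_left algebra_simps)
  show "1 * u = u"
    by (rule cl_eqI) (simp add: coeff_times cl_times_coeff_def coeff_one)
  show "u * 1 = u"
  proof (rule cl_eqI)
    fix C
    have "symd A C = {} \<longleftrightarrow> A = C" for A :: "nat set"
      by (auto simp: symd_def)
    then have "cl_coeff (u * 1) C = (\<Sum>A\<in>Pow N. if A = C then cl_coeff u A else 0)"
      unfolding coeff_times cl_times_coeff_superset[OF fN(1) su] coeff_one
      by (intro sum.cong) auto
    also have "\<dots> = cl_coeff u C"
      using su fN by (subst sum.delta) auto
    finally show "cl_coeff (u * 1) C = cl_coeff u C" .
  qed
  show "(0::clifford) \<noteq> 1"
    by (metis coeff_0 coeff_one zero_neq_one)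
qed

end

definition cl_e :: "nat \<Rightarrow> clifford" where
  "cl_e j = blade {j}"

definition Cl :: "nat \<Rightarrow> clifford set" where
  "Cl r = span {prod_list (map cl_e js) | js. set js \<subseteq> {1..r}}"

definition Cl0 :: "nat \<Rightarrow> clifford set" where
  "Cl0 r = span {prod_list (map cl_e js) | js. set js \<subseteq> {1..r} \<and> even (length js)}"

definition spin :: "nat \<Rightarrow> clifford set" where
  "spin r = span {cl_e i * cl_e j | i j. 1 \<le> i \<and> i < j \<and> j \<le> r}"

lemma blade_times:
  assumes "finite A" "finite B"
  shows "blade A * blade B = cl_sign A B *\<^sub>R blade (symd A B)"
proof (rule cl_eqI)
  fix C
  have "symd A C = B \<longleftrightarrow> C = symd A B"
    by (metis symd_cancel)
  moreover have "{A'. cl_coeff (blade A) A' \<noteq> 0} \<subseteq> {A}"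
    by (auto simp: coeff_blade)
  ultimately show "cl_coeff (blade A * blade B) C = cl_coeff (cl_sign A B *\<^sub>R blade (symd A B)) C"
    using assms by (simp add: coeff_times cl_times_coeff_superset[of "{A}"] coeff_blade)
qed

lemma cl_e_blade: "finite A \<Longrightarrow> cl_e j * blade A = cl_sign {j} A *\<^sub>R blade (symd {j} A)"
  by (simp add: cl_e_def blade_times)

lemma cl_e_anticommute: "cl_e j * cl_e k + cl_e k * cl_e j = (if j = k then -2 else 0)"
proof (cases "j = k")
  case True
  have "cl_e j * cl_e j = - 1"
    by (simp add: cl_e_def blade_times cl_sign_singleton one_clifford_def)
  then show ?thesis using True by simp
next
  case False
  have "cl_sign {k} {j} = - cl_sign {j} {k}"
    using False by (auto simp: cl_sign_singleton)
  then show ?thesis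
    using False by (simp add: cl_e_def blade_times symd_comm[of "{k}" "{j}"])
qed

lemma spin_subset_Cl0: "spin r \<subseteq> Cl0 r"
  unfolding spin_def Cl0_def
proof (rule span_mono, safe)
  fix i j :: nat assume "1 \<le> i" "i < j" "j \<le> r"
  then show "\<exists>js. cl_e i * cl_e j = prod_list (map cl_e js) \<and> set js \<subseteq> {1..r} \<and> even (length js)"
    by (intro exI[of _ "[i, j]"]) auto
qed

definition cl_monomial :: "(nat \<Rightarrow> 'a::real_algebra_1) \<Rightarrow> nat set \<Rightarrow> 'a" where
  "cl_monomial x A = prod_list (map x (sorted_list_of_set A))"

lemma cl_monomial_insert:
  assumes "finite A" "\<And>a. a \<in> A \<Longrightarrow> m < a"
  shows "cl_monomial x (insert m A) = x m * cl_monomial x A"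
proof -
  have "Min (insert m A) = m"
    using assms by (intro Min_eqI) (auto intro: less_imp_le)
  moreover have "insert m A - {m} = A" using assms by auto
  ultimately show ?thesis
    using sorted_list_of_set_nonempty[of "insert m A"] assms by (simp add: cl_monomial_def)
qed

lemma finite_nat_set_min_induct [consumes 1, case_names empty insert]:
  assumes "finite (A :: nat set)" "P {}"
    "\<And>m A. finite A \<Longrightarrow> (\<And>a. a \<in> A \<Longrightarrow> m < a) \<Longrightarrow> P A \<Longrightarrow> P (insert m A)"
  shows "P A"
  using assms(1)
proof (induction A rule: finite_linorder_min_induct)
  case empty
  then show ?case using assms(2) .
next
  case (insert m A)
  then show ?case using assms(3) by blast
qed

lemma cl_monomial_cl_e: "finite A \<Longrightarrow> cl_monomial cl_e A = blade A"
proof (induction A rule: finite_nat_set_min_induct)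
  case empty
  then show ?case by (simp add: cl_monomial_def one_clifford_def)
next
  case (insert m A)
  have "symd {m} A = insert m A"
    using insert.hyps(2) by (force simp: symd_def)
  moreover have "cl_sign {m} A = 1"
    using insert.hyps(2) by (intro cl_sign_less) auto
  ultimately show ?case
    using insert by (simp add: cl_monomial_insert cl_e_blade)
qed

lemma Cl_eq_span_blades: "Cl r = span (blade ` Pow {1..r})"
proof
  have "\<exists>c A. A \<subseteq> {1..r} \<and> prod_list (map cl_e js) = c *\<^sub>R blade A" if "set js \<subseteq> {1..r}" for js
    using that
  proof (induction js)
    case Nil
    then show ?case
      by (intro exI[of _ 1] exI[of _ "{}"]) (simp add: one_clifford_def)
  next
    case (Cons j js)
    then obtain c A where "A \<subseteq> {1..r}" "prod_list (map cl_e js) = c *\<^sub>R blade A" by auto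
    moreover have "finite A" using calculation(1) finite_subset by blast
    ultimately show ?case
      using Cons.prems
      by (intro exI[of _ "c * cl_sign {j} A"] exI[of _ "symd {j} A"])
        (simp add: cl_e_blade symd_subset)
  qed
  then have "{prod_list (map cl_e js) | js. set js \<subseteq> {1..r}} \<subseteq> span (blade ` Pow {1..r})"
    by (force intro: span_scale span_base)
  then show "Cl r \<subseteq> span (blade ` Pow {1..r})"
    unfolding Cl_def by (rule span_minimal) simp
  have "blade A \<in> {prod_list (map cl_e js) | js. set js \<subseteq> {1..r}}" if "A \<subseteq> {1..r}" for A
  proof -
    have "finite A" using that finite_subset by blast
    then have "prod_list (map cl_e (sorted_list_of_set A)) = blade A"
      using cl_monomial_cl_e by (simp add: cl_monomial_def)
    then show ?thesis
      using that \<open>finite A\<close> by (intro CollectI exI[of _ "sorted_list_of_set A"]) simp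
  qed
  then show "span (blade ` Pow {1..r}) \<subseteq> Cl r"
    unfolding Cl_def by (intro span_mono) auto
qed

lemma cl_monomial_times:
  fixes x :: "nat \<Rightarrow> 'a::real_algebra_1"
  assumes rel: "\<And>j k. j \<in> J \<Longrightarrow> k \<in> J \<Longrightarrow> x j * x k + x k * x j = (if j = k then -2 else 0)"
  assumes "finite A" "finite B" "A \<subseteq> J" "B \<subseteq> J"
  shows "cl_monomial x A * cl_monomial x B = cl_sign A B *\<^sub>R cl_monomial x (symd A B)"
proof -
  have sq: "x j * x j = -1" if "j \<in> J" for j
  proof -
    have "2 *\<^sub>R (x j * x j) = 2 *\<^sub>R (-1)"
      using rel[OF that that] by (simp add: scaleR_conv_of_real mult_2)
    then show ?thesis by (subst (asm) scaleR_left_imp_eq) auto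
  qed
  have anti: "x j * x k = - (x k * x j)" if "j \<in> J" "k \<in> J" "j \<noteq> k" for j k
    using rel[OF that(1,2)] that(3) by (simp add: eq_neg_iff_add_eq_0)
  have one: "x i * cl_monomial x B = cl_sign {i} B *\<^sub>R cl_monomial x (symd {i} B)"
    if "finite B" "B \<subseteq> J" "i \<in> J" for i B
    using that(1,2)
  proof (induction B rule: finite_nat_set_min_induct)
    case empty
    then show ?case by (simp add: cl_monomial_def)
  next
    case (insert m B)
    have mJ: "m \<in> J" "B \<subseteq> J" using insert.prems by auto
    have mB: "m \<notin> B" using insert.hyps(2) by blast
    have IH: "x i * cl_monomial x B = cl_sign {i} B *\<^sub>R cl_monomial x (symd {i} B)"
      using insert.IH mJ by blast
    have sgn: "cl_sign {i} (insert m B) = cl_sign {i} {m} * cl_sign {i} B"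
    proof -
      have "insert m B = symd {m} B" using mB by (auto simp: symd_def)
      then show ?thesis using insert.hyps by (simp add: cl_sign_symd_right)
    qed
    consider "i < m" | "i = m" | "m < i" by linarith
    then show ?case
    proof cases
      case 1
      then have all: "\<And>a. a \<in> insert m B \<Longrightarrow> i < a" using insert.hyps by force
      then have "symd {i} (insert m B) = insert i (insert m B)"
        by (force simp: symd_def)
      moreover have "cl_sign {i} (insert m B) = 1"
        using all by (intro cl_sign_less) auto
      ultimately show ?thesis
        using all insert.hyps(1) cl_monomial_insert[of "insert m B" i x] by simp
    next
      case 2
      then have "symd {i} (insert m B) = B" using mB by (auto simp: symd_def)
      moreover have "cl_sign {i} B = 1"
        using 2 insert.hyps by (intro cl_sign_less) auto
      ultimately show ?thesis
        using 2 cl_monomial_insert[OF insert.hyps(1,2), of x] sq[OF mJ(1)] sgn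
        by (simp add: cl_sign_singleton flip: mult.assoc)
    next
      case 3
      have *: "symd {i} (insert m B) = insert m (symd {i} B)"
        using 3 mB by (auto simp: symd_def)
      have "x i * cl_monomial x (insert m B) = - (x m * (x i * cl_monomial x B))"
        using 3 anti[OF that(3) mJ(1)] cl_monomial_insert[OF insert.hyps(1,2), of x]
        by (simp flip: mult.assoc)
      also have "\<dots> = - (cl_sign {i} B *\<^sub>R (x m * cl_monomial x (symd {i} B)))"
        by (simp add: IH)
      also have "x m * cl_monomial x (symd {i} B) = cl_monomial x (insert m (symd {i} B))"
        by (rule cl_monomial_insert[symmetric]) (use 3 insert.hyps in \<open>auto simp: symd_def\<close>)
      finally show ?thesis
        using 3 by (simp add: sgn cl_sign_singleton *)
    qed
  qed
  show ?thesis
    using assms(2,4)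
  proof (induction A rule: finite_nat_set_min_induct)
    case empty
    then show ?case by (simp add: cl_monomial_def)
  next
    case (insert m A)
    have mJ: "m \<in> J" "A \<subseteq> J" using insert.prems by auto
    have mA: "insert m A = symd {m} A" using insert.hyps(2) by (force simp: symd_def)
    have 1: "cl_sign {m} A = 1" using insert.hyps by (intro cl_sign_less) auto
    have "cl_monomial x (insert m A) * cl_monomial x B = x m * (cl_monomial x A * cl_monomial x B)"
      by (simp add: cl_monomial_insert[OF insert.hyps(1,2)] mult.assoc)
    also have "\<dots> = cl_sign A B *\<^sub>R (x m * cl_monomial x (symd A B))"
      using insert.IH mJ by simp
    also have "x m * cl_monomial x (symd A B)
        = cl_sign {m} (symd A B) *\<^sub>R cl_monomial x (symd {m} (symd A B))"
      using one insert.hyps(1) assms(3,5) mJ symd_subset by (metis finite_symd)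
    finally show ?case
      using insert.hyps(1) assms(3)
      by (simp add: mA cl_sign_symd_left cl_sign_symd_right 1 symd_assoc mult.commute)
  qed
qed

lemma Cl_universal:
  fixes x :: "nat \<Rightarrow> 'a::real_algebra_1"
  assumes rel: "\<And>j k. j \<in> {1..r} \<Longrightarrow> k \<in> {1..r} \<Longrightarrow>
    x j * x k + x k * x j = (if j = k then -2 else 0)"
  shows "\<exists>h :: clifford \<Rightarrow> 'a. linear h \<and> h 1 = 1 \<and> (\<forall>j\<in>{1..r}. h (cl_e j) = x j) \<and>
    (\<forall>u\<in>Cl r. \<forall>v\<in>Cl r. h (u * v) = h u * h v)"
proof -
  define h where "h u = (\<Sum>A | cl_coeff u A \<noteq> 0. cl_coeff u A *\<^sub>R cl_monomial x A)" for u
  have sup: "h u = (\<Sum>A\<in>S. cl_coeff u A *\<^sub>R cl_monomial x A)"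
    if "finite S" "{A. cl_coeff u A \<noteq> 0} \<subseteq> S" for u S
    unfolding h_def using that by (intro sum.mono_neutral_left) auto
  have lin: "linear h"
  proof (rule linearI)
    fix u v
    let ?S = "{A. cl_coeff u A \<noteq> 0} \<union> {A. cl_coeff v A \<noteq> 0}"
    have "finite ?S" by (simp add: cl_finite_supp)
    then have "h (u + v) = (\<Sum>A\<in>?S. cl_coeff (u + v) A *\<^sub>R cl_monomial x A)"
        "h u = (\<Sum>A\<in>?S. cl_coeff u A *\<^sub>R cl_monomial x A)"
        "h v = (\<Sum>A\<in>?S. cl_coeff v A *\<^sub>R cl_monomial x A)"
      by (intro sup; auto)+
    then show "h (u + v) = h u + h v"
      by (simp add: scaleR_add_left sum.distrib)
  next
    fix c u
    have "h (c *\<^sub>R u) = (\<Sum>A | cl_coeff u A \<noteq> 0. cl_coeff (c *\<^sub>R u) A *\<^sub>R cl_monomial x A)"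
      by (rule sup) (auto simp: cl_finite_supp)
    then show "h (c *\<^sub>R u) = c *\<^sub>R h u"
      by (simp add: h_def scaleR_sum_right)
  qed
  have hb: "h (blade A) = cl_monomial x A" if "finite A" for A
    using that by (subst sup[of "{A}"]) (auto simp: coeff_blade)
  have mult: "h (blade A * blade B) = h (blade A) * h (blade B)"
    if "A \<subseteq> {1..r}" "B \<subseteq> {1..r}" for A B
  proof -
    have fin: "finite A" "finite B" using that finite_subset by blast+
    then show ?thesis
      using cl_monomial_times[OF rel fin that] by (simp add: blade_times hb linear_scale[OF lin])
  qed
  have mult1: "h (u * blade B) = h u * h (blade B)" if "u \<in> Cl r" "B \<subseteq> {1..r}" for u B
    using that(1) unfolding Cl_eq_span_blades
  proof (induction rule: span_induct_alt)
    case base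
    then show ?case by (simp add: linear_0[OF lin])
  next
    case (step c u v)
    then show ?case
      using mult that(2) by (auto simp: distrib_right linear_add[OF lin] linear_scale[OF lin])
  qed
  have "h (u * v) = h u * h v" if "u \<in> Cl r" "v \<in> Cl r" for u v
    using that(2) unfolding Cl_eq_span_blades
  proof (induction rule: span_induct_alt)
    case base
    then show ?case by (simp add: linear_0[OF lin])
  next
    case (step c w v)
    then show ?case
      using mult1 that(1) by (auto simp: distrib_left linear_add[OF lin] linear_scale[OF lin])
  qed
  moreover have "h 1 = 1" "\<And>j. h (cl_e j) = x j"
    by (simp_all add: one_clifford_def cl_e_def hb cl_monomial_def)
  ultimately show ?thesis using lin by blast
qed


section \<open>Quaternions\<close>

datatype quat = Quat (qr: real) (qi: real) (qj: real) (qk: real)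

instantiation quat :: real_algebra_1
begin

definition "0 = Quat 0 0 0 0"
definition "1 = Quat 1 0 0 0"
definition "p + q = Quat (qr p + qr q) (qi p + qi q) (qj p + qj q) (qk p + qk q)"
definition "p - q = Quat (qr p - qr q) (qi p - qi q) (qj p - qj q) (qk p - qk q)"
definition "- q = Quat (- qr q) (- qi q) (- qj q) (- qk q)"
definition "c *\<^sub>R q = Quat (c * qr q) (c * qi q) (c * qj q) (c * qk q)"
definition "p * q = Quat
  (qr p * qr q - qi p * qi q - qj p * qj q - qk p * qk q)
  (qr p * qi q + qi p * qr q + qj p * qk q - qk p * qj q)
  (qr p * qj q - qi p * qk q + qj p * qr q + qk p * qi q)
  (qr p * qk q + qi p * qj q - qj p * qi q + qk p * qr q)"

instance
  by standard
    (simp_all add: zero_quat_def one_quat_def plus_quat_def minus_quat_def uminus_quat_def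
      scaleR_quat_def times_quat_def algebra_simps)

end

definition qcnj :: "quat \<Rightarrow> quat" where
  "qcnj q = Quat (qr q) (- qi q) (- qj q) (- qk q)"


section \<open>Matrix Lie algebras\<close>

text \<open>All are viewed as Lie algebras over the reals.\<close>

definition bracket :: "'a::ring_1^'n^'n \<Rightarrow> 'a^'n^'n \<Rightarrow> 'a^'n^'n" where
  "bracket X Y = X ** Y - Y ** X"

definition so_alg :: "(real^'n^'n) set" where
  "so_alg = {A. transpose A = - A}"

definition u_alg :: "(complex^'n^'n) set" where
  "u_alg = {A. map_matrix cnj (transpose A) = - A}"

definition sp_alg :: "(quat^'n^'n) set" where
  "sp_alg = {A. map_matrix qcnj (transpose A) = - A}"

definition centralizer :: "('a::ring_1^'n^'n) set \<Rightarrow> ('a^'n^'n) set \<Rightarrow> ('a^'n^'n) set" where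
  "centralizer g k = {X \<in> g. \<forall>Y\<in>k. bracket X Y = 0}"

definition lie_isomorphic ::
    "('a::real_algebra_1^'n^'n) set \<Rightarrow> ('b::real_algebra_1^'k^'k) set \<Rightarrow> bool" where
  "lie_isomorphic g h \<longleftrightarrow> (\<exists>\<phi>. bij_betw \<phi> g h \<and>
     (\<forall>X\<in>g. \<forall>Y\<in>g. \<phi> (X + Y) = \<phi> X + \<phi> Y) \<and>
     (\<forall>c::real. \<forall>X\<in>g. \<phi> (c *\<^sub>R X) = c *\<^sub>R \<phi> X) \<and>
     (\<forall>X\<in>g. \<forall>Y\<in>g. \<phi> (bracket X Y) = bracket (\<phi> X) (\<phi> Y)))"


section \<open>Representations of the even Clifford algebra\<close>

text \<open>
  Representations are on \<open>real^'d\<close>, that is, in coordinates with respect to an orthonormal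
  basis of the representation space. Only the values of \<open>\<rho>\<close> on \<open>Cl0 r\<close> matter.
\<close>

definition Cl0_rep :: "nat \<Rightarrow> (clifford \<Rightarrow> real^'d^'d) \<Rightarrow> bool" where
  "Cl0_rep r \<rho> \<longleftrightarrow>
     (\<forall>a\<in>Cl0 r. \<forall>b\<in>Cl0 r. \<rho> (a + b) = \<rho> a + \<rho> b) \<and>
     (\<forall>c::real. \<forall>a\<in>Cl0 r. \<rho> (c *\<^sub>R a) = c *\<^sub>R \<rho> a) \<and>
     (\<forall>a\<in>Cl0 r. \<forall>b\<in>Cl0 r. \<rho> (a * b) = \<rho> a ** \<rho> b) \<and>
     \<rho> 1 = mat 1"

definition Cl0_irreducible :: "nat \<Rightarrow> (clifford \<Rightarrow> real^'d^'d) \<Rightarrow> bool" where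
  "Cl0_irreducible r \<rho> \<longleftrightarrow>
     (\<forall>W. subspace W \<and> (\<forall>a\<in>Cl0 r. \<forall>w\<in>W. \<rho> a *v w \<in> W) \<longrightarrow> W = {0} \<or> W = UNIV)"

text \<open>Only used for \<open>r\<close> not divisible by 4.\<close>

definition spin_dim :: "nat \<Rightarrow> nat" where
  "spin_dim r = (if r mod 8 \<in> {1, 2, 6, 7} then 2 ^ (r div 2) else 2 ^ (r div 2 + 1))"

text \<open>The Kronecker product is the matrix of the tensor product of two endomorphisms.\<close>

definition kron :: "real^'d^'d \<Rightarrow> real^'m^'m \<Rightarrow> real^('d \<times> 'm)^('d \<times> 'm)" where
  "kron A B = (\<chi> p q. A $ fst p $ fst q * B $ snd p $ snd q)"

definition spin_hat :: "nat \<Rightarrow> (clifford \<Rightarrow> real^'d^'d) \<Rightarrow> (real^('d \<times> 'm::finite)^('d \<times> 'm)) set" where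
  "spin_hat r \<rho> = (\<lambda>A. kron (\<rho> A) (mat 1)) ` spin r"

end

theory Submission
  imports Defs
begin

text \<open>
  Let \<open>K\<close> be the commutant of \<open>\<rho>(Cl0 r)\<close> in the real \<open>d \<times> d\<close> matrices. It is closed under
  transposition because the blades act orthogonally, and by irreducibility and the spectral
  theorem its symmetric elements are scalar. Nonscalar elements can therefore be corrected to
  skew square roots of \<open>-1\<close>, and a \<open>K\<close> of dimension 1, 2 or 4 is the reals, the complex numbers
  or the quaternions, with transposition as conjugation.

  The even blades form a group up to sign, of order \<open>2 ^ (r - 1)\<close>, and only the trivial one has
  nonzero trace (for even \<open>r\<close> the volume element is skew because \<open>r mod 4 = 2\<close>). Hence the
  character formula gives \<open>2 ^ (r - 1) * dim K = d\<^sup>2\<close>, so the known value of \<open>d\<close> alone decides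
  between the three cases and no periodicity of Clifford algebras is needed. Finally, a skew
  matrix commutes with the action on \<open>m\<close> copies of the representation iff it is an \<open>m \<times> m\<close>
  matrix over \<open>K\<close> that is skew-Hermitian for the conjugation of \<open>K\<close>.
\<close>

subsection \<open>Real square matrices\<close>

text \<open>Provides the rules \<open>matrix_mult.add_left\<close>,
  \<open>matrix_mult.scaleR_left\<close>, \<open>matrix_mult.sum_left\<close> and their companions
  for matrix products.\<close>

interpretation matrix_mult: bounded_bilinear
  "(**) :: real^'n::finite^'n \<Rightarrow> real^'n^'n \<Rightarrow> real^'n^'n"
proof -
  have "bilinear ((**) :: real^'n^'n \<Rightarrow> real^'n^'n \<Rightarrow> real^'n^'n)"
    by (auto simp: bilinear_def matrix_matrix_mult_def vec_eq_iff sum.distrib sum_distrib_left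
        algebra_simps intro!: linearI)
  then show "bounded_bilinear ((**) :: real^'n^'n \<Rightarrow> real^'n^'n \<Rightarrow> real^'n^'n)"
    by (simp add: bilinear_conv_bounded_bilinear)
qed

lemma linear_transpose: "linear (transpose :: real^'n^'m \<Rightarrow> real^'m^'n)"
  by (auto simp: transpose_def vec_eq_iff intro!: linearI)

lemmas transpose_add = linear_add[OF linear_transpose]
lemmas transpose_scaleR = linear_scale[OF linear_transpose]
lemmas transpose_uminus = linear_neg[OF linear_transpose]

text \<open>The inner product of the nested vector type is the Frobenius one. Hence the adjoint of
  multiplication by a matrix is multiplication by its transpose.\<close>

lemma inner_matrix_trace: "A \<bullet> B = trace (transpose A ** B)" for A B :: "real^'n^'n"
proof -
  have "A \<bullet> B = (\<Sum>i\<in>UNIV. \<Sum>j\<in>UNIV. A $ i $ j * B $ i $ j)"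
    by (simp add: inner_vec_def)
  also have "\<dots> = trace (transpose A ** B)"
    unfolding trace_def matrix_matrix_mult_def transpose_def
    by (simp, rule sum.swap)
  finally show ?thesis .
qed

lemma inner_matrix_mult_left:
  fixes A B C :: "real^'n^'n"
  shows "(A ** B) \<bullet> C = B \<bullet> (transpose A ** C)"
  by (simp add: inner_matrix_trace matrix_transpose_mul matrix_mul_assoc)

lemma inner_matrix_mult_right:
  fixes A B C :: "real^'n^'n"
  shows "(A ** B) \<bullet> C = A \<bullet> (C ** transpose B)"
  by (simp add: inner_matrix_trace matrix_transpose_mul matrix_mul_assoc)
    (metis matrix_mul_assoc trace_mul_sym)

lemma trace_transpose: "trace (transpose A) = trace A"
  by (simp add: trace_def transpose_def)

text \<open>A maximiser \<open>x\<close> of the Rayleigh quotient on the unit sphere is an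
  eigenvector: a nonzero residual \<open>w\<close> would be a direction along which the quotient
  could be increased.\<close>

lemma symmetric_matrix_eigenvector:
  fixes A :: "real^'n^'n"
  assumes sym: "transpose A = A"
  obtains c v where "v \<noteq> 0" "A *v v = c *\<^sub>R v"
proof -
  have "continuous_on (sphere 0 1) (\<lambda>x. x \<bullet> (A *v x))"
    by (intro continuous_intros linear_continuous_on
        bounded_linear.linear matrix_vector_mul_bounded_linear)
  moreover have "compact (sphere 0 1 :: (real^'n) set)" "sphere 0 1 \<noteq> ({} :: (real^'n) set)"
    by simp_all
  ultimately obtain x where x: "x \<in> sphere 0 1"
      and mx: "\<And>y. y \<in> sphere 0 1 \<Longrightarrow> y \<bullet> (A *v y) \<le> x \<bullet> (A *v x)"
    using continuous_attains_sup[of "sphere 0 1 :: (real^'n) set"] by blast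
  define c where "c = x \<bullet> (A *v x)"
  define w where "w = c *\<^sub>R x - A *v x"
  \<comment> \<open>Maximality on the sphere extends to all vectors by homogeneity.\<close>
  have le: "y \<bullet> (A *v y) \<le> c * (y \<bullet> y)" for y
  proof (cases "y = 0")
    case False
    have "(y /\<^sub>R norm y) \<bullet> (A *v (y /\<^sub>R norm y)) \<le> c"
      unfolding c_def by (rule mx) (use False in simp)
    then have "(y \<bullet> (A *v y)) / (norm y)\<^sup>2 \<le> c"
      by (simp add: matrix_vector_mult_scaleR power2_eq_square divide_inverse mult_ac)
    then show ?thesis
      using False by (simp add: field_simps power2_norm_eq_inner)
  qed simp
  have xx: "x \<bullet> x = 1" using x by (simp flip: power2_norm_eq_inner)
  have swap: "x \<bullet> (A *v w) = w \<bullet> (A *v x)"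
    by (metis dot_lmul_matrix inner_commute sym transpose_matrix_vector)
  have ww: "w \<bullet> (A *v x) = c * (w \<bullet> x) - w \<bullet> w"
    by (simp add: w_def algebra_simps inner_commute)
  define K where "K = c * (w \<bullet> w) - w \<bullet> (A *v w)"
  \<comment> \<open>This is \<open>le\<close> at \<open>x + t *\<^sub>R w\<close>: the constant
    terms cancel because \<open>x\<close> attains the bound, and the linear coefficient is twice the
    squared length of the residual.\<close>
  have quad: "0 \<le> 2 * t * (w \<bullet> w) + t\<^sup>2 * K" for t
  proof -
    have 1: "(x + t *\<^sub>R w) \<bullet> (A *v (x + t *\<^sub>R w))
        = c + 2 * t * (w \<bullet> (A *v x)) + t\<^sup>2 * (w \<bullet> (A *v w))"
      using swap by (simp add: matrix_vector_right_distrib matrix_vector_mult_scaleR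
          inner_add_left inner_add_right power2_eq_square c_def algebra_simps)
    have 2: "(x + t *\<^sub>R w) \<bullet> (x + t *\<^sub>R w) = 1 + 2 * t * (w \<bullet> x) + t\<^sup>2 * (w \<bullet> w)"
      by (simp add: inner_add_left inner_add_right power2_eq_square xx inner_commute algebra_simps)
    show ?thesis
      using le[of "x + t *\<^sub>R w"] unfolding 1 2 by (simp add: ww K_def algebra_simps)
  qed
  have "w \<bullet> w = 0"
  proof (rule ccontr)
    assume "w \<bullet> w \<noteq> 0"
    then have pos: "w \<bullet> w > 0" by simp
    \<comment> \<open>A negative \<open>t\<close> so small that the linear term dominates:
      \<open>t * K\<close> is at least \<open>t * (\<bar>K\<bar> + 1)\<close>, which equals
      \<open>- (w \<bullet> w)\<close>. The summand 1 keeps the denominator positive.\<close>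
    define t where "t = - (w \<bullet> w) / (\<bar>K\<bar> + 1)"
    have t: "t < 0" "t * (\<bar>K\<bar> + 1) = - (w \<bullet> w)"
      using pos by (simp_all add: t_def divide_less_0_iff)
    have "t * K \<ge> t * (\<bar>K\<bar> + 1)"
      using t by (intro mult_left_mono_neg) auto
    then have "2 * (w \<bullet> w) + t * K > 0" using t pos by linarith
    then have "t * (2 * (w \<bullet> w) + t * K) < 0" using t mult_neg_pos by blast
    then show False using quad[of t] by (simp add: power2_eq_square algebra_simps)
  qed
  then have "A *v x = c *\<^sub>R x" by (simp add: w_def)
  moreover have "x \<noteq> 0" using x by auto
  ultimately show ?thesis using that by blast
qed

subsection \<open>The commutant of a projective group of orthogonal matrices\<close>

definition commutant :: "(real^'n^'n) set \<Rightarrow> (real^'n^'n) set" where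
  "commutant F = {T. \<forall>M\<in>F. T ** M = M ** T}"

lemma subspace_commutant: "subspace (commutant F)"
  by (auto simp: subspace_def commutant_def matrix_mult.add_left matrix_mult.add_right
      matrix_mult.scaleR_left matrix_mult.scaleR_right matrix_mult.zero_left matrix_mult.zero_right)

text \<open>
  Averaging over conjugation gives the orthogonal projection onto the commutant; both sides
  below are its trace, up to the factor \<open>card E\<close>.
\<close>

lemma card_times_dim_commutant:
  fixes M :: "'i \<Rightarrow> real^'n^'n"
  assumes fin: "finite E"
    and orth: "\<And>a. a \<in> E \<Longrightarrow> orthogonal_matrix (M a)"
    and perm: "\<And>b. b \<in> E \<Longrightarrow> bij_betw (p b) E E"
    and mult: "\<And>a b. a \<in> E \<Longrightarrow> b \<in> E \<Longrightarrow> M b ** M a = s b a *\<^sub>R M (p b a)"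
    and sign: "\<And>a b. a \<in> E \<Longrightarrow> b \<in> E \<Longrightarrow> s b a * s b a = (1::real)"
  shows "real (card E * dim (commutant (M ` E))) = (\<Sum>a\<in>E. (trace (M a))\<^sup>2)"
proof -
  let ?K = "commutant (M ` E)" and ?N = "real (card E)"
  define P where "P T = (\<Sum>a\<in>E. M a ** T ** transpose (M a))" for T
  have MT: "M a ** transpose (M a) = mat 1" "transpose (M a) ** M a = mat 1" if "a \<in> E" for a
    using orth[OF that] by (simp_all add: orthogonal_matrix_def)
  have conj: "M b ** P T ** transpose (M b) = P T" if b: "b \<in> E" for b T
  proof -
    have "M b ** P T ** transpose (M b)
        = (\<Sum>a\<in>E. (M b ** M a) ** T ** transpose (M b ** M a))"
      by (simp add: P_def matrix_mult.sum_left matrix_mult.sum_right matrix_transpose_mul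
          matrix_mul_assoc)
    \<comment> \<open>The scalar \<open>s b a\<close> enters twice, once through the transpose, and
      cancels. So a projective group is enough.\<close>
    also have "\<dots> = (\<Sum>a\<in>E. M (p b a) ** T ** transpose (M (p b a)))"
      using b sign by (intro sum.cong refl)
        (simp add: mult matrix_mult.scaleR_left matrix_mult.scaleR_right transpose_scaleR)
    also have "\<dots> = P T"
      unfolding P_def by (rule sum.reindex_bij_betw[OF perm[OF b]])
    finally show ?thesis .
  qed
  have PK: "P T \<in> ?K" for T
    unfolding commutant_def
  proof (safe)
    fix b assume b: "b \<in> E"
    have "P T ** M b = M b ** P T ** transpose (M b) ** M b" by (simp add: conj b)
    also have "\<dots> = M b ** P T ** (transpose (M b) ** M b)" by (simp only: matrix_mul_assoc)
    finally show "P T ** M b = M b ** P T" using MT[OF b] by simp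
  qed
  \<comment> \<open>Conjugation by an orthogonal matrix is an isometry and fixes every
    \<open>S\<close> in the commutant.\<close>
  have inner_P: "P T \<bullet> S = ?N * (T \<bullet> S)" if S: "S \<in> ?K" for S T
  proof -
    have "(M a ** T ** transpose (M a)) \<bullet> S = T \<bullet> S" if a: "a \<in> E" for a
    proof -
      have "transpose (M a) ** (S ** M a) = S"
        using S a MT[OF a] by (simp add: commutant_def matrix_mul_assoc)
      then show ?thesis
        by (metis inner_matrix_mult_left inner_matrix_mult_right transpose_transpose)
    qed
    then show ?thesis by (simp add: P_def inner_sum_left)
  qed
  obtain B where B: "B \<subseteq> ?K" "pairwise orthogonal B" "\<And>x. x \<in> B \<Longrightarrow> norm x = 1"
      "independent B" "card B = dim ?K" "span B = ?K"
    using orthonormal_basis_subspace[OF subspace_commutant] by metis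
  have finB: "finite B" using B(4) independent_imp_finite by blast
  \<comment> \<open>Matrix units form an orthonormal basis, so summing the \<open>i j\<close> entry
    of \<open>P (e i j)\<close> gives the trace of \<open>P\<close> as an operator on
    matrices.\<close>
  define e :: "'n \<Rightarrow> 'n \<Rightarrow> real^'n^'n" where "e i j = axis i (axis j 1)" for i j
  have e: "T \<bullet> e i j = T $ i $ j" "e i j \<bullet> T = T $ i $ j" for T i j
    by (simp_all add: e_def inner_axis inner_axis' inner_commute)
  have "P (e i j) $ i $ j = (\<Sum>b\<in>B. ?N * (b $ i $ j * b $ i $ j))" for i j
  proof -
    have "P (e i j) = (\<Sum>b\<in>B. (P (e i j) \<bullet> b) *\<^sub>R b)"
      using orthonormal_basis_expand[OF B(2,3) _ finB] PK B(6) by metis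
    also have "\<dots> = (\<Sum>b\<in>B. (?N * b $ i $ j) *\<^sub>R b)"
      using B(1) by (intro sum.cong) (auto simp: inner_P e)
    finally have "P (e i j) = (\<Sum>b\<in>B. (?N * b $ i $ j) *\<^sub>R b)" .
    then show ?thesis by (simp add: sum_component mult.assoc)
  qed
  then have "(\<Sum>i\<in>UNIV. \<Sum>j\<in>UNIV. P (e i j) $ i $ j)
      = (\<Sum>i\<in>UNIV. \<Sum>j\<in>UNIV. \<Sum>b\<in>B. ?N * (b $ i $ j * b $ i $ j))" by simp
  also have "\<dots> = (\<Sum>b\<in>B. \<Sum>i\<in>UNIV. \<Sum>j\<in>UNIV. ?N * (b $ i $ j * b $ i $ j))"
    by (simp only: sum.swap[of _ B])
  also have "\<dots> = (\<Sum>b\<in>B. ?N * (b \<bullet> b))"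
    by (simp add: inner_vec_def sum_distrib_left)
  also have "\<dots> = ?N * card B"
    using B(3) by (simp add: norm_eq_1)
  finally have 1: "(\<Sum>i\<in>UNIV. \<Sum>j\<in>UNIV. P (e i j) $ i $ j) = ?N * card B" .
  \<comment> \<open>Conjugation by \<open>A\<close> contributes the product of two diagonal entries,
    and these sum to the squared trace of \<open>A\<close>.\<close>
  have ent: "(A ** e i j ** transpose A) $ i $ j = A $ i $ i * A $ j $ j" for A :: "real^'n^'n" and i j
  proof -
    have comp: "e i j $ l $ k = (if l = i then if k = j then 1 else 0 else 0)" for l k
      by (simp add: e_def axis_def)
    have left: "(A ** e i j) $ i $ k = (if k = j then A $ i $ i else 0)" for k
      by (simp add: matrix_matrix_mult_def comp if_distrib[of "\<lambda>x. _ * x"] cong: if_cong)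
    have "(A ** e i j ** transpose A) $ i $ j = (\<Sum>k\<in>UNIV. (A ** e i j) $ i $ k * A $ j $ k)"
      by (simp add: matrix_matrix_mult_def[of "A ** e i j"] transpose_def)
    also have "\<dots> = A $ i $ i * A $ j $ j"
      by (simp add: left if_distrib[of "\<lambda>x. x * _"] cong: if_cong)
    finally show ?thesis .
  qed
  have "(\<Sum>i\<in>UNIV. \<Sum>j\<in>UNIV. P (e i j) $ i $ j)
      = (\<Sum>i\<in>UNIV. \<Sum>j\<in>UNIV. \<Sum>a\<in>E. M a $ i $ i * M a $ j $ j)"
    by (simp add: P_def sum_component ent)
  also have "\<dots> = (\<Sum>a\<in>E. \<Sum>i\<in>UNIV. \<Sum>j\<in>UNIV. M a $ i $ i * M a $ j $ j)"
    by (simp only: sum.swap[of _ E])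
  also have "\<dots> = (\<Sum>a\<in>E. (trace (M a))\<^sup>2)"
    by (simp add: trace_def power2_eq_square sum_product)
  finally show ?thesis using 1 B(5) by simp
qed

subsection \<open>Matrix algebras whose symmetric elements are scalar\<close>

text \<open>The conjugation is a parameter, so that \<open>id\<close>, \<open>cnj\<close> and
  \<open>qcnj\<close> fall under one notion.\<close>

definition star_embedding ::
    "('k::real_algebra_1 \<Rightarrow> 'k) \<Rightarrow> ('k \<Rightarrow> real^'n^'n) \<Rightarrow> bool" where
  "star_embedding cj h \<longleftrightarrow> linear h \<and> inj h \<and> (\<forall>p q. h (p * q) = h p ** h q) \<and>
     (\<forall>q. h (cj q) = transpose (h q))"

lemma span_eq_if_pairwise_orthogonal:
  fixes S :: "'a::euclidean_space set"
  assumes "S \<subseteq> K" "subspace K" "pairwise orthogonal S" "0 \<notin> S" "card S = dim K"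
  shows "span S = K"
proof
  have "independent S" using assms(3,4) by (rule pairwise_orthogonal_independent)
  then show "K \<subseteq> span S"
    using assms(1,5) by (intro card_ge_dim_independent) (auto dest: independent_imp_finite)
  show "span S \<subseteq> K" using assms(1,2) by (rule span_minimal)
qed

text \<open>A dimension count makes \<open>span S\<close> a proper subspace of \<open>K\<close>. The
  vector found becomes, after rescaling, the next imaginary unit.\<close>

lemma exists_orthogonal_in_subspace:
  fixes K :: "'a::euclidean_space set"
  assumes "subspace K" "S \<subseteq> K" "finite S" "card S < dim K"
  obtains x where "x \<in> K" "x \<noteq> 0" "\<And>y. y \<in> S \<Longrightarrow> x \<bullet> y = 0"
proof -
  have "span S \<subseteq> span K" using assms(2) by (rule span_mono)
  moreover have "dim (span S) \<noteq> dim (span K)"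
    using dim_le_card'[OF assms(3)] assms(4) unfolding dim_span by linarith
  ultimately have "span S \<subset> span K" by (metis psubsetI)
  then show ?thesis
    using orthogonal_to_subspace_exists_gen[of S K] that assms(1)
    by (metis orthogonal_def span_base span_eq_iff)
qed

text \<open>The properties of the commutant that determine its structure;
  \<open>symmetric_scalar\<close> is Schur's lemma for symmetric endomorphisms.\<close>

locale scalar_star_algebra =
  fixes K :: "(real^'n^'n) set"
  assumes subspace: "subspace K"
    and one: "mat 1 \<in> K"
    and mult: "A \<in> K \<Longrightarrow> B \<in> K \<Longrightarrow> A ** B \<in> K"
    and transpose: "A \<in> K \<Longrightarrow> transpose A \<in> K"
    and symmetric_scalar: "A \<in> K \<Longrightarrow> transpose A = A \<Longrightarrow> \<exists>c. A = c *\<^sub>R mat 1"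
begin

lemma inner_one: "A \<bullet> (mat 1 :: real^'n^'n) = trace A"
  by (simp add: inner_matrix_trace trace_transpose)

lemma inner_one_one: "(mat 1 :: real^'n^'n) \<bullet> mat 1 = CARD('n)"
  by (simp add: inner_one trace_I)

lemma one_nonzero: "(mat 1 :: real^'n^'n) \<noteq> 0"
  using inner_one_one by auto

text \<open>The symmetric part of \<open>A\<close> is scalar, and it has trace zero.\<close>

lemma skew_if_orthogonal_one:
  assumes "A \<in> K" "A \<bullet> mat 1 = 0"
  shows "transpose A = - A"
proof -
  have "A + transpose A \<in> K"
    using assms transpose by (simp add: subspace_add[OF subspace])
  moreover have "transpose (A + transpose A) = A + transpose A"
    by (simp add: transpose_add)
  ultimately obtain c where c: "A + transpose A = c *\<^sub>R mat 1"
    using symmetric_scalar by blast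
  have "(A + transpose A) \<bullet> mat 1 = 0"
    using assms(2) by (simp add: inner_add_left inner_one trace_transpose trace_add)
  then have "c = 0" by (simp add: c inner_one_one)
  then show ?thesis using c by (simp add: add_eq_0_iff)
qed

lemma skew_orthogonal_one:
  fixes A :: "real^'n^'n"
  assumes "transpose A = - A" shows "A \<bullet> mat 1 = 0"
  using assms by (metis inner_minus_left inner_one trace_transpose neg_equal_zero)

text \<open>The square of a skew \<open>A\<close> is symmetric, hence a scalar \<open>c\<close>. It
  is negative since \<open>A \<bullet> A\<close> is minus the trace of that square, so division by
  \<open>sqrt (- c)\<close> normalises it.\<close>

lemma skew_unit:
  assumes "A \<in> K" "A \<bullet> mat 1 = 0" "A \<noteq> 0"
  obtains k where "k *\<^sub>R A \<in> K" "transpose (k *\<^sub>R A) = - (k *\<^sub>R A)"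
    "(k *\<^sub>R A) ** (k *\<^sub>R A) = - mat 1"
proof -
  have sk: "transpose A = - A" using assms(1,2) by (rule skew_if_orthogonal_one)
  have "transpose (A ** A) = A ** A"
    by (simp add: matrix_transpose_mul sk matrix_mult.minus_left matrix_mult.minus_right)
  then obtain c where c: "A ** A = c *\<^sub>R mat 1"
    using symmetric_scalar mult assms(1) by blast
  have "A \<bullet> A = - trace (A ** A)"
    by (simp add: inner_matrix_trace sk matrix_mult.minus_left trace_def sum_negf)
  also have "\<dots> = - (c * CARD('n))" using inner_one_one by (simp add: c flip: inner_one)
  finally have "c * CARD('n) < 0" using assms(3) by (metis inner_gt_zero_iff neg_0_less_iff_less)
  then have neg: "c < 0" by (simp add: mult_less_0_iff)
  show ?thesis
  proof (rule that[of "1 / sqrt (- c)"])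
    show "(1 / sqrt (- c)) *\<^sub>R A \<in> K" using assms(1) subspace by (simp add: subspace_scale)
    show "transpose ((1 / sqrt (- c)) *\<^sub>R A) = - ((1 / sqrt (- c)) *\<^sub>R A)"
      by (simp add: transpose_scaleR sk)
    have "inverse (sqrt (- c)) * (inverse (sqrt (- c)) * c) = -1"
      using neg by (simp add: field_simps)
    then show "((1 / sqrt (- c)) *\<^sub>R A) ** ((1 / sqrt (- c)) *\<^sub>R A) = - mat 1"
      by (simp add: matrix_mult.scaleR_left matrix_mult.scaleR_right c divide_inverse)
  qed
qed

lemma inner_unit:
  fixes A :: "real^'n^'n"
  assumes "transpose A = - A" "A ** A = - mat 1"
  shows "A \<bullet> A = CARD('n)"
proof -
  have "transpose A ** A = mat 1"
    by (simp add: assms matrix_mult.minus_left)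
  then show ?thesis by (simp add: inner_matrix_trace trace_I)
qed

section \<open>Copies of the reals, the complex numbers and the quaternions\<close>

lemma real_embedding:
  assumes "dim K = 1"
  obtains h where "star_embedding (id :: real \<Rightarrow> real) h" "range h = K"
proof
  let ?h = "\<lambda>c::real. c *\<^sub>R (mat 1 :: real^'n^'n)"
  show "star_embedding id ?h"
    unfolding star_embedding_def
    by (auto simp: transpose_scaleR scaleR_left_distrib one_nonzero matrix_mult.scaleR_left
        matrix_mult.scaleR_right mult.commute intro!: linearI injI)
  have "span {mat 1 :: real^'n^'n} = K"
    using one subspace one_nonzero assms by (intro span_eq_if_pairwise_orthogonal) auto
  then show "range ?h = K" by (simp add: span_singleton)
qed

lemma complex_embedding:
  assumes "dim K = 2"
  obtains h where "star_embedding cnj h" "range h = K"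
proof -
  obtain A where A: "A \<in> K" "A \<noteq> 0" "A \<bullet> mat 1 = 0"
    using exists_orthogonal_in_subspace[OF subspace, of "{mat 1}"] one assms by auto
  obtain k where "k *\<^sub>R A \<in> K" "transpose (k *\<^sub>R A) = - (k *\<^sub>R A)"
      "(k *\<^sub>R A) ** (k *\<^sub>R A) = - mat 1"
    using skew_unit[OF A(1,3,2)] by blast
  then obtain I where I: "I \<in> K" "transpose I = - I" "I ** I = - mat 1" by blast
  have I1: "I \<bullet> mat 1 = 0" and II: "I \<bullet> I = CARD('n)"
    using I skew_orthogonal_one inner_unit by blast+
  have ne: "I \<noteq> mat 1" "I \<noteq> 0"
    using I1 II inner_one_one by auto
  let ?h = "\<lambda>z. Re z *\<^sub>R mat 1 + Im z *\<^sub>R I"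
  \<comment> \<open>The matrices \<open>mat 1\<close> and \<open>I\<close> are orthogonal with
    squared norm \<open>CARD('n)\<close>, so these inner products recover the coordinates of
    \<open>z\<close>.\<close>
  have inner: "?h z \<bullet> mat 1 = Re z * CARD('n)" "?h z \<bullet> I = Im z * CARD('n)" for z
    using I1 by (simp_all add: inner_add_left inner_one_one II inner_commute[of "mat 1" I])
  have "inj ?h"
  proof (rule injI)
    fix z w assume "?h z = ?h w"
    then have "Re z * CARD('n) = Re w * CARD('n)" "Im z * CARD('n) = Im w * CARD('n)"
      using inner by metis+
    then show "z = w" by (simp add: complex_eq_iff)
  qed
  then have "star_embedding cnj ?h"
    unfolding star_embedding_def
    by (auto simp: transpose_add transpose_scaleR I algebra_simps matrix_mult.add_left
        matrix_mult.add_right matrix_mult.scaleR_left matrix_mult.scaleR_right intro!: linearI)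
  moreover have "span {mat 1, I} = K"
    using one I I1 ne one_nonzero assms subspace
    by (intro span_eq_if_pairwise_orthogonal)
      (auto simp: pairwise_insert orthogonal_def inner_commute[of "mat 1" I])
  then have "range ?h = K"
  proof -
    have "T \<in> range ?h" if T: "T \<in> span {mat 1, I}" for T
    proof -
      obtain a b where "T - a *\<^sub>R mat 1 - b *\<^sub>R I = 0"
        using T unfolding span_breakdown_eq span_empty singleton_iff by blast
      then have "T = ?h (Complex a b)" by (simp add: algebra_simps)
      then show ?thesis by blast
    qed
    moreover have "?h z \<in> K" for z
      using one I(1) subspace by (simp add: subspace_add subspace_scale)
    ultimately show ?thesis using \<open>span {mat 1, I} = K\<close> by blast
  qed
  ultimately show ?thesis using that by blast
qed

text \<open>Two orthogonal imaginary units \<open>I\<close> and \<open>J\<close> anticommute. With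
  \<open>mat 1\<close> and \<open>I ** J\<close> they form four nonzero pairwise orthogonal
  elements, which exhaust dimension 4.\<close>

lemma quat_embedding:
  assumes "dim K = 4"
  obtains h where "star_embedding qcnj h" "range h = K"
proof -
  obtain A where A: "A \<in> K" "A \<noteq> 0" "A \<bullet> mat 1 = 0"
    using exists_orthogonal_in_subspace[OF subspace, of "{mat 1}"] one assms by auto
  obtain k where "k *\<^sub>R A \<in> K" "transpose (k *\<^sub>R A) = - (k *\<^sub>R A)"
      "(k *\<^sub>R A) ** (k *\<^sub>R A) = - mat 1"
    using skew_unit[OF A(1,3,2)] by blast
  then obtain I where I: "I \<in> K" "transpose I = - I" "I ** I = - mat 1" by blast
  have I1: "I \<bullet> mat 1 = 0" and II: "I \<bullet> I = CARD('n)"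
    using I skew_orthogonal_one inner_unit by blast+
  have sub: "{mat 1, I} \<subseteq> K" and card: "card {mat 1, I} < dim K"
    using one I(1) assms by (simp_all add: card_insert_if)
  obtain B where B0: "B \<in> K" "B \<noteq> 0" "\<And>y. y \<in> {mat 1, I} \<Longrightarrow> B \<bullet> y = 0"
    by (rule exists_orthogonal_in_subspace[OF subspace sub _ card]) simp_all
  then have B: "B \<in> K" "B \<noteq> 0" "B \<bullet> mat 1 = 0" "B \<bullet> I = 0" by simp_all
  obtain k where k: "k *\<^sub>R B \<in> K" "transpose (k *\<^sub>R B) = - (k *\<^sub>R B)"
      "(k *\<^sub>R B) ** (k *\<^sub>R B) = - mat 1"
    using skew_unit[OF B(1,3,2)] by blast
  define J where "J = k *\<^sub>R B"
  have J: "J \<in> K" "transpose J = - J" "J ** J = - mat 1" and JI: "J \<bullet> I = 0"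
    using k B(4) by (simp_all add: J_def)
  have J1: "J \<bullet> mat 1 = 0" and JJ: "J \<bullet> J = CARD('n)"
    using J skew_orthogonal_one inner_unit by blast+
  \<comment> \<open>The adjoint of left multiplication by \<open>I\<close> is that by
    \<open>- I\<close>, which reduces the claim to \<open>JI\<close>.\<close>
  have IJ1: "(I ** J) \<bullet> mat 1 = 0"
    using JI by (simp add: inner_matrix_mult_left I matrix_mult.minus_left)
  have IJ: "I ** J \<in> K" using I(1) J(1) by (rule mult)
  have tIJ: "transpose (I ** J) = - (I ** J)"
    using IJ IJ1 by (rule skew_if_orthogonal_one)
  \<comment> \<open>Transposing \<open>I ** J\<close> gives \<open>J ** I\<close>, as the two signs
    cancel; skewness of the product is therefore anticommutation.\<close>
  have JI_anti: "J ** I = - (I ** J)"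
    using tIJ by (simp add: matrix_transpose_mul I J matrix_mult.minus_left matrix_mult.minus_right)
  \<comment> \<open>With \<open>assoc\<close> these rules reduce every word in \<open>I\<close> and
    \<open>J\<close> to a signed \<open>mat 1\<close>, \<open>I\<close>, \<open>J\<close> or
    \<open>I ** J\<close>.\<close>
  have IIX: "I ** (I ** X) = - X" and JJX: "J ** (J ** X) = - X"
    and JIX: "J ** (I ** X) = - (I ** (J ** X))" for X :: "real^'n^'n"
    by (simp_all add: matrix_mul_assoc I J JI_anti matrix_mult.minus_left)
  have assoc: "(X ** Y) ** Z = X ** (Y ** Z)" for X Y Z :: "real^'n^'n"
    by (simp add: matrix_mul_assoc)
  have IJIJ: "(I ** J) \<bullet> (I ** J) = CARD('n)"
    by (rule inner_unit[OF tIJ]) (simp add: assoc JIX I J matrix_mult.minus_right)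
  have IJI: "(I ** J) \<bullet> I = 0" and IJJ: "(I ** J) \<bullet> J = 0"
    using I1 J1
    by (simp_all add: inner_matrix_mult_left[of I J I] inner_matrix_mult_right[of I J J] I J
        matrix_mult.minus_left matrix_mult.minus_right)
  note flips = inner_commute[of "mat 1" I] inner_commute[of "mat 1" J]
    inner_commute[of "mat 1" "I ** J"] inner_commute[of I J] inner_commute[of I "I ** J"]
    inner_commute[of J "I ** J"]
  have pos: "real CARD('n) \<noteq> 0" by simp
  have ne: "I \<noteq> mat 1" "J \<noteq> mat 1" "I ** J \<noteq> mat 1" "J \<noteq> I" "I ** J \<noteq> I" "I ** J \<noteq> J"
      "I \<noteq> 0" "J \<noteq> 0" "I ** J \<noteq> 0"
    using I1 J1 IJ1 JI IJI IJJ II JJ IJIJ inner_one_one pos by (metis inner_zero_left)+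
  let ?h = "\<lambda>q. qr q *\<^sub>R mat 1 + qi q *\<^sub>R I + qj q *\<^sub>R J + qk q *\<^sub>R (I ** J)"
  have inner: "?h q \<bullet> mat 1 = qr q * CARD('n)" "?h q \<bullet> I = qi q * CARD('n)"
      "?h q \<bullet> J = qj q * CARD('n)" "?h q \<bullet> (I ** J) = qk q * CARD('n)" for q
    by (simp_all add: inner_add_left inner_one_one flips I1 J1 IJ1 II JJ IJIJ JI IJI IJJ)
  have "inj ?h"
  proof (rule injI)
    fix p q assume "?h p = ?h q"
    then have "qr p * CARD('n) = qr q * CARD('n)" "qi p * CARD('n) = qi q * CARD('n)"
        "qj p * CARD('n) = qj q * CARD('n)" "qk p * CARD('n) = qk q * CARD('n)"
      using inner by metis+
    then show "p = q" by (simp add: quat.expand)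
  qed
  moreover have "linear ?h"
    by (rule linearI) (simp_all add: plus_quat_def scaleR_quat_def algebra_simps)
  moreover have "?h (p * q) = ?h p ** ?h q" for p q
    by (simp add: times_quat_def matrix_mult.add_left matrix_mult.add_right
        matrix_mult.scaleR_left matrix_mult.scaleR_right matrix_mult.minus_left
        matrix_mult.minus_right assoc IIX JJX JIX JI_anti I J algebra_simps)
  moreover have "?h (qcnj q) = transpose (?h q)" for q
    by (simp add: qcnj_def transpose_add transpose_scaleR tIJ I J)
  ultimately have "star_embedding qcnj ?h"
    by (simp add: star_embedding_def)
  moreover have "range ?h = K"
  proof -
    have "card {mat 1, I, J, I ** J} = 4"
      using ne by (auto simp: card_insert_if)
    then have sp: "span {mat 1, I, J, I ** J} = K"
      using one I J IJ ne one_nonzero assms subspace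
      by (intro span_eq_if_pairwise_orthogonal)
        (auto simp: pairwise_insert orthogonal_def flips I1 J1 IJ1 JI IJI IJJ)
    have "T \<in> range ?h" if T: "T \<in> span {mat 1, I, J, I ** J}" for T
    proof -
      obtain a b c d where
          "T - a *\<^sub>R mat 1 - b *\<^sub>R I - c *\<^sub>R J - d *\<^sub>R (I ** J) = 0"
        using T unfolding span_breakdown_eq span_empty singleton_iff by blast
      then have "T = ?h (Quat a b c d)" by (simp add: algebra_simps)
      then show ?thesis by blast
    qed
    moreover have "?h q \<in> K" for q
      using one I(1) J(1) IJ subspace by (simp add: subspace_add subspace_scale)
    ultimately show ?thesis using sp by blast
  qed
  ultimately show ?thesis using that by blast
qed

end

subsection \<open>Block matrices\<close>

text \<open>The first index component belongs to the representation and the second numbers its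
  copies, so \<open>block X a b\<close> is the map from copy \<open>b\<close> to copy
  \<open>a\<close>.\<close>

definition block :: "real^('d::finite \<times> 'm::finite)^('d \<times> 'm) \<Rightarrow> 'm \<Rightarrow> 'm \<Rightarrow> real^'d^'d" where
  "block X a b = (\<chi> p q. X $ (p, a) $ (q, b))"

lemma block_eq_iff: "X = Y \<longleftrightarrow> (\<forall>a b. block X a b = block Y a b)"
  by (auto simp: block_def vec_eq_iff)

lemma block_add: "block (X + Y) a b = block X a b + block Y a b"
  and block_scaleR: "block (c *\<^sub>R X) a b = c *\<^sub>R block X a b"
  and block_diff: "block (X - Y) a b = block X a b - block Y a b"
  and block_uminus: "block (- X) a b = - block X a b"
  and block_transpose: "block (transpose X) a b = transpose (block X b a)"
  by (simp_all add: block_def vec_eq_iff transpose_def)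

lemma block_mult: "block (X ** Y) a b = (\<Sum>c\<in>UNIV. block X a c ** block Y c b)"
proof -
  have "(X ** Y) $ (p, a) $ (q, b)
      = (\<Sum>c\<in>UNIV. \<Sum>k\<in>UNIV. X $ (p, a) $ (k, c) * Y $ (k, c) $ (q, b))" for p q
  proof -
    have "(X ** Y) $ (p, a) $ (q, b)
        = (\<Sum>(k, c)\<in>UNIV \<times> UNIV. X $ (p, a) $ (k, c) * Y $ (k, c) $ (q, b))"
      by (simp add: matrix_matrix_mult_def case_prod_unfold)
    also have "\<dots> = (\<Sum>k\<in>UNIV. \<Sum>c\<in>UNIV. X $ (p, a) $ (k, c) * Y $ (k, c) $ (q, b))"
      by (rule sum.cartesian_product[symmetric])
    finally show ?thesis by (subst sum.swap) simp
  qed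
  then show ?thesis
    by (simp add: vec_eq_iff block_def sum_component matrix_matrix_mult_def[of "block _ _ _", unfolded block_def])
qed

lemma block_kron_one: "block (kron M (mat 1)) a b = (if a = b then M else 0)"
  by (simp add: vec_eq_iff block_def kron_def mat_def)

text \<open>\<open>kron M (mat 1)\<close> is block diagonal with \<open>M\<close> in every diagonal
  block.\<close>

lemma commutes_kron_one_iff:
  "X ** kron M (mat 1) = kron M (mat 1) ** X \<longleftrightarrow> (\<forall>a b. block X a b ** M = M ** block X a b)"
  by (simp add: block_eq_iff block_mult block_kron_one if_distrib[of "\<lambda>A. _ ** A"]
      if_distrib[of "\<lambda>A. A ** _"] matrix_mult.zero_left matrix_mult.zero_right cong: if_cong)

text \<open>Each block is read as an element of \<open>'k\<close> through \<open>h\<close>.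
  Transposition swaps the block indices and transposes each block, which becomes the conjugate
  transpose over \<open>'k\<close>.\<close>

lemma lie_isomorphic_skew_blocks:
  fixes h :: "'k::real_algebra_1 \<Rightarrow> real^'d^'d"
  assumes h: "star_embedding cj h" and K: "range h = K"
  shows "lie_isomorphic {X \<in> so_alg :: (real^('d \<times> 'm::finite)^('d \<times> 'm)) set. \<forall>a b. block X a b \<in> K}
    {A :: 'k^'m^'m. map_matrix cj (transpose A) = - A}"
    (is "lie_isomorphic ?C ?H")
proof -
  have lin: "linear h" and inj: "inj h" and mult: "\<And>p q. h (p * q) = h p ** h q"
    and star: "\<And>q. h (cj q) = transpose (h q)"
    using h by (auto simp: star_embedding_def)
  define \<psi> :: "'k^'m^'m \<Rightarrow> real^('d \<times> 'm)^('d \<times> 'm)" where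
    "\<psi> A = (\<chi> s t. h (A $ snd s $ snd t) $ fst s $ fst t)" for A
  define \<phi> :: "real^('d \<times> 'm)^('d \<times> 'm) \<Rightarrow> 'k^'m^'m" where
    "\<phi> X = (\<chi> a b. inv h (block X a b))" for X
  have block_\<psi>: "block (\<psi> A) a b = h (A $ a $ b)" for A a b
    by (simp add: block_def \<psi>_def vec_eq_iff)
  have \<phi>\<psi>: "\<phi> (\<psi> A) = A" for A
    by (simp add: \<phi>_def block_\<psi> vec_eq_iff inv_f_f[OF inj])
  \<comment> \<open>Membership in \<open>?C\<close> matters here: \<open>inv h\<close> is a right
    inverse of \<open>h\<close> only over its range \<open>K\<close>.\<close>
  have \<psi>\<phi>: "\<psi> (\<phi> X) = X" if "X \<in> ?C" for X
    using that K by (auto simp: block_eq_iff block_\<psi> \<phi>_def intro: f_inv_into_f)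
  have add: "\<psi> (A + B) = \<psi> A + \<psi> B" for A B
    by (simp add: block_eq_iff block_\<psi> block_add linear_add[OF lin])
  have scale: "\<psi> (c *\<^sub>R A) = c *\<^sub>R \<psi> A" for c A
    by (simp add: block_eq_iff block_\<psi> block_scaleR linear_scale[OF lin])
  have br: "\<psi> (bracket A B) = bracket (\<psi> A) (\<psi> B)" for A B
    by (simp add: block_eq_iff bracket_def block_\<psi> block_diff block_mult matrix_matrix_mult_def[of A B]
        matrix_matrix_mult_def[of B A] linear_diff[OF lin] linear_sum[OF lin] mult)
  have \<psi>C: "\<psi> A \<in> ?C \<longleftrightarrow> A \<in> ?H" for A
  proof -
    have "transpose (\<psi> A) = - \<psi> A \<longleftrightarrow> (\<forall>a b. h (cj (A $ b $ a)) = h (- (A $ a $ b)))"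
      by (simp add: block_eq_iff block_transpose block_uminus block_\<psi> star linear_neg[OF lin])
    also have "\<dots> \<longleftrightarrow> (\<forall>a b. cj (A $ b $ a) = - (A $ a $ b))"
      by (simp only: inj_eq[OF inj])
    also have "\<dots> \<longleftrightarrow> A \<in> ?H"
      by (simp add: vec_eq_iff transpose_def)
    finally show ?thesis using K by (auto simp: so_alg_def block_\<psi>)
  qed
  \<comment> \<open>\<open>\<psi>\<close> respects all operations on all matrices, so its left
    inverse \<open>\<phi>\<close> inherits these laws on \<open>?C\<close>.\<close>
  have hom: "\<phi> Z = W" if "Z = \<psi> W" for Z W
    by (simp only: that \<phi>\<psi>)
  have "bij_betw \<phi> ?C ?H"
  proof (rule bij_betw_byWitness[where f' = \<psi>])
    show "\<forall>X\<in>?C. \<psi> (\<phi> X) = X" using \<psi>\<phi> by blast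
    show "\<forall>A\<in>?H. \<phi> (\<psi> A) = A" using \<phi>\<psi> by blast
    show "\<phi> ` ?C \<subseteq> ?H" by (rule image_subsetI) (rule iffD1[OF \<psi>C], subst \<psi>\<phi>, assumption+)
    show "\<psi> ` ?H \<subseteq> ?C" by (rule image_subsetI) (rule iffD2[OF \<psi>C])
  qed
  moreover have "\<phi> (X + Y) = \<phi> X + \<phi> Y" "\<phi> (c *\<^sub>R X) = c *\<^sub>R \<phi> X"
      "\<phi> (bracket X Y) = bracket (\<phi> X) (\<phi> Y)" if "X \<in> ?C" "Y \<in> ?C" for X Y c
    using \<psi>\<phi>[OF that(1)] \<psi>\<phi>[OF that(2)] by (auto intro!: hom simp: add scale br)
  ultimately show ?thesis
    unfolding lie_isomorphic_def by blast
qed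

subsection \<open>Signs and traces of blades\<close>

text \<open>The index set of the even blades; under \<open>symd\<close> it is an elementary abelian
  2-group.\<close>

definition even_subsets :: "nat \<Rightarrow> nat set set" where
  "even_subsets r = {A. A \<subseteq> {1..r} \<and> even (card A)}"

lemma finite_even_subsets: "finite (even_subsets r)"
  unfolding even_subsets_def by (rule finite_subset[of _ "Pow {1..r}"]) auto

lemma finite_if_even_subset: "A \<in> even_subsets r \<Longrightarrow> finite A"
  by (auto simp: even_subsets_def intro: finite_subset)

lemma even_card_symd:
  assumes "finite A" "finite B"
  shows "even (card (symd A B)) \<longleftrightarrow> (even (card A) \<longleftrightarrow> even (card B))"
proof -
  have "(-1::real) ^ card (symd A B) = (-1) ^ card A * (-1) ^ card B"
    using assms by (rule minus_one_card_symd)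
  then show ?thesis by (cases "even (card A)"; cases "even (card B)"; cases "even (card (symd A B))") auto
qed

lemma symd_even_subsets:
  assumes "A \<in> even_subsets r" "B \<in> even_subsets r"
  shows "symd A B \<in> even_subsets r"
proof -
  have "finite A" "finite B" using assms finite_if_even_subset by blast+
  then show ?thesis using assms by (simp add: even_subsets_def even_card_symd symd_subset)
qed

text \<open>Toggling the element 1, which lies in \<open>{1..r}\<close> as \<open>r > 0\<close>,
  exchanges even and odd subsets.\<close>

lemma card_even_subsets:
  assumes "r > 0"
  shows "card (even_subsets r) = 2 ^ (r - 1)"
proof -
  let ?O = "{A. A \<subseteq> {1..r} \<and> odd (card A)}"
  have fin: "finite A" if "A \<subseteq> {1..r}" for A
    using that by (rule finite_subset) simp
  have sub: "symd {1} A \<subseteq> {1..r}" "even (card (symd {1} A)) \<longleftrightarrow> odd (card A)"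
    if "A \<subseteq> {1..r}" for A
    using that assms fin[OF that] by (simp_all add: symd_subset even_card_symd)
  have "bij_betw (symd {1}) (even_subsets r) ?O"
    by (rule bij_betw_byWitness[where f' = "symd {1}"])
      (use sub in \<open>auto simp only: even_subsets_def symd_cancel mem_Collect_eq image_subset_iff Ball_def\<close>)
  then have "card (even_subsets r) = card ?O" by (rule bij_betw_same_card)
  moreover have "card (even_subsets r \<union> ?O) = card (even_subsets r) + card ?O"
    by (rule card_Un_disjoint)
      (auto simp: finite_even_subsets even_subsets_def intro: finite_subset[of _ "Pow {1..r}"])
  moreover have "even_subsets r \<union> ?O = Pow {1..r}" by (auto simp: even_subsets_def)
  ultimately have "2 * card (even_subsets r) = 2 ^ r" by (simp add: card_Pow)
  then show ?thesis using assms by (cases r) auto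
qed

lemma cl_sign_square: "cl_sign A B * cl_sign A B = 1"
  by (simp add: cl_sign_def flip: power_add)

text \<open>The two signs count the elements of \<open>A\<close> below and above \<open>i\<close>,
  with \<open>i\<close> itself counted twice if present; the even cardinality of \<open>A\<close>
  drops out.\<close>

lemma cl_sign_swap_singleton:
  assumes "finite A" "even (card A)"
  shows "cl_sign {i} A * cl_sign A {i} = (if i \<in> A then -1 else 1)"
proof -
  let ?L = "{b \<in> A. b \<le> i}" and ?U = "{a \<in> A. i \<le> a}"
  have "{(a, b). a \<in> {i} \<and> b \<in> A \<and> b \<le> a} = Pair i ` ?L"
      "{(a, b). a \<in> A \<and> b \<in> {i} \<and> b \<le> a} = (\<lambda>a. (a, i)) ` ?U" by auto
  then have "cl_sign {i} A * cl_sign A {i} = (-1) ^ (card ?L + card ?U)"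
    by (simp add: cl_sign_def card_image inj_on_def power_add)
  also have "card ?L + card ?U = card (?L \<union> ?U) + card (?L \<inter> ?U)"
    using assms(1) by (intro card_Un_Int) auto
  also have "?L \<union> ?U = A" by auto
  also have "?L \<inter> ?U = (if i \<in> A then {i} else {})" by auto
  finally show ?thesis using assms(2) by (simp add: power_add)
qed

text \<open>A bivector that shares exactly one index with an even blade anticommutes with
  it.\<close>

lemma cl_sign_swap_pair:
  assumes "finite A" "even (card A)" "i \<in> A" "j \<notin> A"
  shows "cl_sign {i, j} A * cl_sign A {i, j} = -1"
proof -
  have "{i, j} = symd {i} {j}" using assms(3,4) by (auto simp: symd_def)
  then have "cl_sign {i, j} A * cl_sign A {i, j}
      = (cl_sign {i} A * cl_sign A {i}) * (cl_sign {j} A * cl_sign A {j})"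
    using assms(1) by (simp add: cl_sign_symd_left cl_sign_symd_right)
  then show ?thesis using assms by (simp add: cl_sign_swap_singleton)
qed

text \<open>The volume element squares to -1: the number of counted pairs is the triangular number
  of \<open>r\<close>, which is odd for \<open>r = 4 * k + 2\<close>.\<close>

lemma cl_sign_top:
  assumes "r mod 4 = 2"
  shows "cl_sign {1..r} {1..r} = -1"
proof -
  have "{(a, b). a \<in> {1..r} \<and> b \<in> {1..r} \<and> b \<le> a} = Sigma {1..r} (\<lambda>a. {1..a})" by auto
  then have "card {(a, b). a \<in> {1..r} \<and> b \<in> {1..r} \<and> b \<le> a} = \<Sum>{1..r}" by simp
  moreover have "\<Sum>{1..r} = r * (r + 1) div 2" using gauss_sum_nat[of r] by (simp add: atLeast0AtMost atLeast1_atMost_eq_remove0 sum_diff1_nat)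
  moreover have "odd (r * (r + 1) div 2)"
  proof -
    obtain k where "r = 4 * k + 2" using assms by (metis mod_div_mult_eq add.commute mult.commute)
    then have "r * (r + 1) div 2 = (2 * k + 1) * (4 * k + 3)" by (simp add: algebra_simps)
    then show ?thesis by simp
  qed
  ultimately show ?thesis by (simp add: cl_sign_def)
qed

subsection \<open>Irreducible orthogonal representations of the even Clifford algebra\<close>

text \<open>Transposing the relation gives commutation with \<open>transpose M\<close>, the inverse
  of \<open>M\<close>; conjugating by \<open>M\<close> turns this into commutation with
  \<open>M\<close>.\<close>

lemma commutant_transpose:
  assumes orth: "\<And>M. M \<in> F \<Longrightarrow> orthogonal_matrix M" and T: "T \<in> commutant F"
  shows "transpose T \<in> commutant F"
  unfolding commutant_def
proof safe
  fix M assume M: "M \<in> F"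
  have MM: "M ** transpose M = mat 1" "transpose M ** M = mat 1"
    using orth[OF M] by (simp_all add: orthogonal_matrix_def)
  have eq: "transpose T ** transpose M = transpose M ** transpose T"
    using T M by (simp add: commutant_def flip: matrix_transpose_mul)
  have "transpose T ** M = M ** (transpose M ** transpose T) ** M"
    by (simp add: MM matrix_mul_assoc)
  also have "\<dots> = M ** transpose T ** (transpose M ** M)"
    by (simp only: matrix_mul_assoc flip: eq)
  finally show "transpose T ** M = M ** transpose T" by (simp add: MM)
qed

locale irreducible_spin_rep =
  fixes r :: nat and \<rho> :: "clifford \<Rightarrow> real^'d::finite^'d"
  assumes r: "r > 1" "r mod 4 \<noteq> 0"
    and rep: "Cl0_rep r \<rho>" and irreducible: "Cl0_irreducible r \<rho>"
    and skew: "\<And>i j. 1 \<le> i \<Longrightarrow> i < j \<Longrightarrow> j \<le> r \<Longrightarrow>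
      transpose (\<rho> (cl_e i * cl_e j)) = - \<rho> (cl_e i * cl_e j)"
begin

section \<open>Orthogonality of the action of even words\<close>

lemma rho_add: "a \<in> Cl0 r \<Longrightarrow> b \<in> Cl0 r \<Longrightarrow> \<rho> (a + b) = \<rho> a + \<rho> b"
  and rho_scaleR: "a \<in> Cl0 r \<Longrightarrow> \<rho> (c *\<^sub>R a) = c *\<^sub>R \<rho> a"
  and rho_mult: "a \<in> Cl0 r \<Longrightarrow> b \<in> Cl0 r \<Longrightarrow> \<rho> (a * b) = \<rho> a ** \<rho> b"
  and rho_one: "\<rho> 1 = mat 1"
  using rep by (auto simp: Cl0_rep_def)

lemma subspace_Cl0: "subspace (Cl0 r)"
  by (simp add: Cl0_def)

lemma prod_list_in_Cl0:
  "set js \<subseteq> {1..r} \<Longrightarrow> even (length js) \<Longrightarrow> prod_list (map cl_e js) \<in> Cl0 r"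
  unfolding Cl0_def by (rule span_base) blast

lemma one_in_Cl0: "1 \<in> Cl0 r"
  using prod_list_in_Cl0[of "[]"] by simp

lemma pair_in_Cl0: "i \<in> {1..r} \<Longrightarrow> j \<in> {1..r} \<Longrightarrow> cl_e i * cl_e j \<in> Cl0 r"
  using prod_list_in_Cl0[of "[i, j]"] by simp

lemma rho_uminus: "a \<in> Cl0 r \<Longrightarrow> \<rho> (- a) = - \<rho> a"
  using rho_scaleR[of a "-1"] by simp

lemma cl_e_square: "cl_e i * cl_e i = - 1"
  by (simp add: cl_e_def blade_times cl_sign_singleton one_clifford_def)

text \<open>Reduces an arbitrary pair of generators to \<open>i < j\<close>, the range of
  \<open>skew\<close>: equal indices give \<open>- mat 1\<close>, and a swap costs a sign.\<close>

lemma rho_pair_cases: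
  assumes "i \<in> {1..r}" "j \<in> {1..r}"
    and "\<And>i j. i \<in> {1..r} \<Longrightarrow> j \<in> {1..r} \<Longrightarrow> i < j \<Longrightarrow> P (\<rho> (cl_e i * cl_e j))"
    and "P (- mat 1)"
    and "\<And>A. P A \<Longrightarrow> P (- A)"
  shows "P (\<rho> (cl_e i * cl_e j))"
proof -
  consider "i < j" | "i = j" | "j < i" by linarith
  then show ?thesis
  proof cases
    case 2
    then show ?thesis
      using assms(4) by (simp add: cl_e_square rho_uminus one_in_Cl0 rho_one)
  next
    case 3
    then have "cl_e i * cl_e j = - (cl_e j * cl_e i)"
      using cl_e_anticommute[of i j] by (simp add: eq_neg_iff_add_eq_0)
    then have "\<rho> (cl_e i * cl_e j) = - \<rho> (cl_e j * cl_e i)"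
      using assms(1,2) by (simp add: rho_uminus pair_in_Cl0)
    then show ?thesis using 3 assms by simp
  qed (use assms in auto)
qed

text \<open>A skew matrix with square \<open>- mat 1\<close> is orthogonal.\<close>

lemma orthogonal_pair:
  assumes "i \<in> {1..r}" "j \<in> {1..r}"
  shows "orthogonal_matrix (\<rho> (cl_e i * cl_e j))"
  using assms
proof (rule rho_pair_cases[where P = orthogonal_matrix])
  fix i j assume less: "i \<in> {1..r}" "j \<in> {1..r}" "i < j"
  have "cl_e j * cl_e i = - (cl_e i * cl_e j)"
    using less(3) cl_e_anticommute[of j i] by (simp add: eq_neg_iff_add_eq_0)
  then have "(cl_e i * cl_e j) * (cl_e i * cl_e j) = - (cl_e i * (cl_e i * cl_e j) * cl_e j)"
    by (metis mult.assoc mult_minus_left mult_minus_right)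
  also have "\<dots> = - ((cl_e i * cl_e i) * (cl_e j * cl_e j))"
    by (simp only: mult.assoc)
  also have "\<dots> = - 1" by (simp add: cl_e_square)
  finally have "\<rho> (cl_e i * cl_e j) ** \<rho> (cl_e i * cl_e j) = - mat 1"
    using less by (metis pair_in_Cl0 rho_mult rho_one rho_uminus one_in_Cl0)
  then show "orthogonal_matrix (\<rho> (cl_e i * cl_e j))"
    using less skew[of i j] by (simp add: orthogonal_matrix matrix_mult.minus_left)
qed (simp_all add: orthogonal_matrix transpose_uminus matrix_mult.minus_left matrix_mult.minus_right)

lemma orthogonal_prod_list:
  assumes "set js \<subseteq> {1..r}" "even (length js)"
  shows "orthogonal_matrix (\<rho> (prod_list (map cl_e js)))"
  using assms
proof (induction js rule: induct_list012)
  \<comment> \<open>Generators are split off in pairs, because \<open>\<rho>\<close> is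
    multiplicative only on \<open>Cl0 r\<close>.\<close>
  case (3 i j js)
  then have "\<rho> (prod_list (map cl_e (i # j # js)))
      = \<rho> (cl_e i * cl_e j) ** \<rho> (prod_list (map cl_e js))"
    by (simp add: rho_mult pair_in_Cl0 prod_list_in_Cl0 flip: mult.assoc)
  then show ?case using 3 by (simp add: orthogonal_matrix_mul orthogonal_pair)
qed (simp_all add: rho_one orthogonal_matrix_id)

lemma commutant_span:
  assumes "S \<subseteq> Cl0 r" "T \<in> commutant (\<rho> ` S)"
  shows "T \<in> commutant (\<rho> ` span S)"
proof -
  have "span S \<subseteq> {a \<in> Cl0 r. T ** \<rho> a = \<rho> a ** T}"
  proof (rule span_minimal)
    have "\<rho> 0 = 0" using rho_scaleR[OF one_in_Cl0, of 0] by simp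
    then show "subspace {a \<in> Cl0 r. T ** \<rho> a = \<rho> a ** T}"
      using subspace_Cl0 by (auto simp: subspace_def rho_add rho_scaleR matrix_mult.add_left
          matrix_mult.add_right matrix_mult.scaleR_left matrix_mult.scaleR_right
          matrix_mult.zero_left matrix_mult.zero_right)
  qed (use assms in \<open>auto simp: commutant_def\<close>)
  then show ?thesis by (auto simp: commutant_def)
qed

text \<open>The bivectors generate \<open>Cl0 r\<close> as an algebra, every even word being a
  product of pairs.\<close>

lemma commutant_spin_subset: "commutant (\<rho> ` spin r) \<subseteq> commutant (\<rho> ` Cl0 r)"
proof
  fix T assume T: "T \<in> commutant (\<rho> ` spin r)"
  have pair: "T ** \<rho> (cl_e i * cl_e j) = \<rho> (cl_e i * cl_e j) ** T"
    if "i \<in> {1..r}" "j \<in> {1..r}" for i j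
    using that
  proof (rule rho_pair_cases[where P = "\<lambda>A. T ** A = A ** T"])
    fix i j assume less: "i \<in> {1..r}" "j \<in> {1..r}" "i < j"
    then have "cl_e i * cl_e j \<in> spin r"
      unfolding spin_def by (intro span_base) auto
    then show "T ** \<rho> (cl_e i * cl_e j) = \<rho> (cl_e i * cl_e j) ** T"
      using T by (simp add: commutant_def)
  qed (simp_all add: matrix_mult.minus_left matrix_mult.minus_right)
  have "T ** \<rho> (prod_list (map cl_e js)) = \<rho> (prod_list (map cl_e js)) ** T"
    if "set js \<subseteq> {1..r}" "even (length js)" for js
    using that
  proof (induction js rule: induct_list012)
    case (3 i j js)
    then have eq: "\<rho> (prod_list (map cl_e (i # j # js)))
        = \<rho> (cl_e i * cl_e j) ** \<rho> (prod_list (map cl_e js))"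
      by (simp add: rho_mult pair_in_Cl0 prod_list_in_Cl0 flip: mult.assoc)
    have "T ** \<rho> (prod_list (map cl_e js)) = \<rho> (prod_list (map cl_e js)) ** T"
        "T ** \<rho> (cl_e i * cl_e j) = \<rho> (cl_e i * cl_e j) ** T"
      using 3 pair by auto
    then show ?case unfolding eq by (metis matrix_mul_assoc)
  qed (simp_all add: rho_one)
  then have "T \<in> commutant (\<rho> ` {prod_list (map cl_e js) | js. set js \<subseteq> {1..r} \<and> even (length js)})"
    by (auto simp: commutant_def)
  then show "T \<in> commutant (\<rho> ` Cl0 r)"
    unfolding Cl0_def by (rule commutant_span[rotated]) (use prod_list_in_Cl0 in blast)
qed

section \<open>The even blades as a projective group of matrices\<close>

abbreviation M :: "nat set \<Rightarrow> real^'d^'d" where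
  "M A \<equiv> \<rho> (blade A)"

lemma blade_as_prod_list:
  assumes "A \<in> even_subsets r"
  obtains js where "set js \<subseteq> {1..r}" "even (length js)" "blade A = prod_list (map cl_e js)"
proof
  have fin: "finite A" using assms by (rule finite_if_even_subset)
  show "set (sorted_list_of_set A) \<subseteq> {1..r}" "even (length (sorted_list_of_set A))"
    using assms fin by (simp_all add: even_subsets_def)
  show "blade A = prod_list (map cl_e (sorted_list_of_set A))"
    using cl_monomial_cl_e[OF fin] by (simp add: cl_monomial_def)
qed

lemma blade_in_Cl0: "A \<in> even_subsets r \<Longrightarrow> blade A \<in> Cl0 r"
  by (metis blade_as_prod_list prod_list_in_Cl0)

lemma orthogonal_M: "A \<in> even_subsets r \<Longrightarrow> orthogonal_matrix (M A)"
  by (metis blade_as_prod_list orthogonal_prod_list)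

lemma M_mult:
  assumes "A \<in> even_subsets r" "B \<in> even_subsets r"
  shows "M A ** M B = cl_sign A B *\<^sub>R M (symd A B)"
  using assms blade_times[of A B] rho_mult[of "blade A" "blade B"]
  by (simp add: finite_if_even_subset blade_in_Cl0 symd_even_subsets rho_scaleR)

lemma M_empty: "M {} = mat 1"
  using rho_one by (simp add: one_clifford_def)

text \<open>Replaces the Lie algebra by a finite family of orthogonal matrices, to which averaging
  applies. The inclusions run in a cycle from \<open>spin r\<close> through \<open>Cl0 r\<close> to
  the blades and back.\<close>

lemma commutant_spin_eq:
  "commutant (\<rho> ` spin r) = commutant (M ` even_subsets r)"
proof -
  have 1: "commutant (\<rho> ` Cl0 r) \<subseteq> commutant (M ` even_subsets r)"
    using blade_in_Cl0 by (auto simp: commutant_def)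
  have 2: "commutant (M ` even_subsets r) \<subseteq> commutant (\<rho> ` spin r)"
  proof
    fix T assume T: "T \<in> commutant (M ` even_subsets r)"
    have "T ** \<rho> (cl_e i * cl_e j) = \<rho> (cl_e i * cl_e j) ** T" if "1 \<le> i" "i < j" "j \<le> r" for i j
    proof -
      have "cl_e i * cl_e j = blade {i, j}"
        using that by (simp add: cl_e_def blade_times cl_sign_singleton symd_def insert_Diff_if insert_commute)
      moreover have "{i, j} \<in> even_subsets r" using that by (simp add: even_subsets_def)
      ultimately show ?thesis using T by (simp add: commutant_def)
    qed
    then have "T \<in> commutant (\<rho> ` {cl_e i * cl_e j | i j. 1 \<le> i \<and> i < j \<and> j \<le> r})"
      by (auto simp: commutant_def)
    then show "T \<in> commutant (\<rho> ` spin r)"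
      unfolding spin_def by (rule commutant_span[rotated]) (auto intro!: pair_in_Cl0)
  qed
  show "commutant (\<rho> ` spin r) = commutant (M ` even_subsets r)"
    using 1 2 commutant_spin_subset by blast
qed

sublocale scalar_star_algebra "commutant (\<rho> ` spin r)"
proof
  show "subspace (commutant (\<rho> ` spin r))" by (rule subspace_commutant)
  show "mat 1 \<in> commutant (\<rho> ` spin r)" by (simp add: commutant_def)
  show "A ** B \<in> commutant (\<rho> ` spin r)"
    if "A \<in> commutant (\<rho> ` spin r)" "B \<in> commutant (\<rho> ` spin r)" for A B
    using that unfolding commutant_def by (auto simp: matrix_mul_assoc) (metis matrix_mul_assoc)
  \<comment> \<open>The blades are used because they act orthogonally, unlike general elements of
    \<open>spin r\<close>.\<close>
  show "transpose A \<in> commutant (\<rho> ` spin r)" if "A \<in> commutant (\<rho> ` spin r)" for A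
    using that commutant_transpose[of "M ` even_subsets r"] orthogonal_M
    unfolding commutant_spin_eq by blast
  show "\<exists>c. A = c *\<^sub>R mat 1" if A: "A \<in> commutant (\<rho> ` spin r)" and sym: "transpose A = A" for A
  proof -
    obtain c v where v: "v \<noteq> 0" "A *v v = c *\<^sub>R v"
      using symmetric_matrix_eigenvector[OF sym] .
    \<comment> \<open>The eigenspace contains \<open>v\<close> and is invariant under every
      \<open>\<rho> a\<close>, so irreducibility makes it the whole space.\<close>
    let ?W = "{w. A *v w = c *\<^sub>R w}"
    have "subspace ?W"
      by (auto simp: subspace_def matrix_vector_right_distrib matrix_vector_mult_scaleR scaleR_right_distrib)
    moreover have "\<rho> a *v w \<in> ?W" if "a \<in> Cl0 r" "w \<in> ?W" for a w
    proof -
      have "A ** \<rho> a = \<rho> a ** A" using A that(1) commutant_spin_subset by (auto simp: commutant_def)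
      then have "A *v (\<rho> a *v w) = \<rho> a *v (A *v w)"
        by (simp add: matrix_vector_mul_assoc)
      then show ?thesis using that(2) by (simp add: matrix_vector_mult_scaleR)
    qed
    ultimately have "?W = {0} \<or> ?W = UNIV"
      using irreducible unfolding Cl0_irreducible_def by blast
    then have "A *v w = (c *\<^sub>R mat 1) *v w" for w
      using v by (auto simp: scaleR_matrix_vector_assoc[symmetric])
    then show ?thesis using matrix_eq by blast
  qed
qed

lemma trace_M:
  assumes A: "A \<in> even_subsets r" and ne: "A \<noteq> {}"
  shows "trace (M A) = 0"
proof (cases "A = {1..r}")
  case True
  then have "even r" using A by (simp add: even_subsets_def)
  then have "r mod 4 = 2" using r by presburger
  then have sq: "M A ** M A = - mat 1"
    using M_mult[OF A A] True cl_sign_top by (simp add: M_empty)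
  \<comment> \<open>An orthogonal matrix with square \<open>- mat 1\<close> is skew and so has trace
    zero.\<close>
  have "transpose (M A) = - (transpose (M A) ** (M A ** M A))"
    by (simp add: sq matrix_mult.minus_right)
  also have "\<dots> = - M A"
    using orthogonal_M[OF A] by (simp add: matrix_mul_assoc orthogonal_matrix)
  finally have "trace (M A) = - trace (M A)"
    by (metis inner_minus_left inner_one trace_transpose)
  then show ?thesis by simp
next
  case False
  moreover have "A \<subseteq> {1..r}" using A by (simp add: even_subsets_def)
  ultimately obtain i j where ij: "i \<in> A" "j \<in> {1..r}" "j \<notin> A"
    using ne by blast
  \<comment> \<open>A nonempty proper \<open>A\<close> has an index inside and one outside.
    Conjugation by the bivector \<open>M B\<close> then negates \<open>M A\<close> but preserves its
    trace.\<close>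
  define B where "B = {i, j}"
  have "card B = 2" using ij by (auto simp: B_def card_insert_if)
  have fin: "finite A" "even (card A)" and B: "B \<in> even_subsets r"
    using A ij finite_if_even_subset[OF A] \<open>card B = 2\<close>
    by (auto simp: even_subsets_def B_def)
  have BB: "M B ** transpose (M B) = mat 1" "transpose (M B) ** M B = mat 1"
    using orthogonal_M[OF B] by (simp_all add: orthogonal_matrix_def)
  have "cl_sign B A = - cl_sign A B"
    using cl_sign_swap_pair[OF fin ij(1,3)] cl_sign_square[of A B] unfolding B_def
    by (smt (verit) mult_cancel_right mult_minus_left mult.commute)
  then have "M B ** M A = - (M A ** M B)"
    using M_mult[OF A B] M_mult[OF B A] by (simp add: symd_comm)
  then have "trace (transpose (M B) ** (M B ** M A)) = - trace (transpose (M B) ** (M A ** M B))"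
    by (simp add: matrix_mult.minus_right trace_def sum_negf)
  also have "trace (transpose (M B) ** (M A ** M B)) = trace (M A ** (M B ** transpose (M B)))"
    by (metis matrix_mul_assoc trace_mul_sym)
  finally show ?thesis by (simp add: BB matrix_mul_assoc)
qed

lemma dim_commutant: "2 ^ (r - 1) * dim (commutant (\<rho> ` spin r)) = CARD('d)\<^sup>2"
proof -
  let ?E = "even_subsets r"
  have "real (card ?E * dim (commutant (M ` ?E))) = (\<Sum>A\<in>?E. (trace (M A))\<^sup>2)"
  proof (rule card_times_dim_commutant[where p = symd and s = cl_sign])
    show "bij_betw (symd B) ?E ?E" if "B \<in> ?E" for B
      by (rule bij_betw_byWitness[where f' = "symd B"]) (use that symd_even_subsets in auto)
  qed (simp_all add: finite_even_subsets orthogonal_M M_mult cl_sign_square)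
  \<comment> \<open>By \<open>trace_M\<close> only the identity contributes to the character
    sum.\<close>
  also have "\<dots> = (\<Sum>A\<in>{{}}. (trace (M A))\<^sup>2)"
    by (rule sum.mono_neutral_right)
      (auto simp: finite_even_subsets trace_M, simp add: even_subsets_def)
  also have "\<dots> = real (CARD('d)\<^sup>2)" by (simp add: M_empty trace_I)
  finally show ?thesis using r by (simp only: of_nat_eq_iff card_even_subsets commutant_spin_eq)
qed

lemma centralizer_spin_hat:
  "centralizer so_alg (spin_hat r \<rho>)
    = {X \<in> so_alg :: (real^('d \<times> 'm::finite)^('d \<times> 'm)) set. \<forall>a b. block X a b \<in> commutant (\<rho> ` spin r)}"
  by (auto simp: centralizer_def spin_hat_def bracket_def commutes_kron_one_iff commutant_def)

end

section \<open>The residue classes modulo 8\<close>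

theorem theorem3p1:
  fixes r :: nat and \<rho> :: "clifford \<Rightarrow> real^'d::finite^'d"
  assumes "r > 1" and "r mod 4 \<noteq> 0"
    and "Cl0_rep r \<rho>" and "Cl0_irreducible r \<rho>"
    and "CARD('d) = spin_dim r"
    and "\<And>i j. 1 \<le> i \<Longrightarrow> i < j \<Longrightarrow> j \<le> r \<Longrightarrow>
      transpose (\<rho> (cl_e i * cl_e j)) = - \<rho> (cl_e i * cl_e j)"
  shows "let C = centralizer (so_alg :: (real^('d \<times> 'm::finite)^('d \<times> 'm)) set) (spin_hat r \<rho>) in
    (r mod 8 \<in> {1, 7} \<longrightarrow> lie_isomorphic C (so_alg :: (real^'m^'m) set)) \<and>
    (r mod 8 \<in> {2, 6} \<longrightarrow> lie_isomorphic C (u_alg :: (complex^'m^'m) set)) \<and>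
    (r mod 8 \<in> {3, 5} \<longrightarrow> lie_isomorphic C (sp_alg :: (quat^'m^'m) set))"
proof -
  interpret irreducible_spin_rep r \<rho>
    by (unfold_locales; rule assms)
  let ?K = "commutant (\<rho> ` spin r)"
  let ?C = "centralizer (so_alg :: (real^('d \<times> 'm)^('d \<times> 'm)) set) (spin_hat r \<rho>)"
  \<comment> \<open>With \<open>2 ^ e\<close> the dimension of the representation,
    \<open>dim_commutant\<close> reads \<open>2 ^ (r - 1) * dim ?K = 2 ^ (2 * e)\<close>, so
    \<open>t\<close> is the excess exponent.\<close>
  have dim: "dim ?K = 2 ^ t" if "2 * e = r - 1 + t" "spin_dim r = 2 ^ e" for e t
  proof -
    have "2 ^ (r - 1) * dim ?K = 2 ^ (r - 1) * 2 ^ t"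
      using dim_commutant assms(5) that by (simp add: power_mult[symmetric] mult.commute flip: power_add)
    then show ?thesis by simp
  qed
  have "lie_isomorphic ?C (so_alg :: (real^'m^'m) set)" if "r mod 8 = 1 \<or> r mod 8 = 7"
  proof -
    have "2 * (r div 2) = r - 1 + 0" using that by presburger
    then have "dim ?K = 1" using dim[of "r div 2" 0] that by (auto simp: spin_dim_def)
    then obtain h where "star_embedding (id :: real \<Rightarrow> real) h" "range h = ?K"
      by (rule real_embedding)
    then have "lie_isomorphic ?C {A :: real^'m^'m. map_matrix id (transpose A) = - A}"
      unfolding centralizer_spin_hat by (rule lie_isomorphic_skew_blocks)
    \<comment> \<open>Conjugation on the reals is \<open>id\<close>.\<close>
    moreover have "so_alg = {A :: real^'m^'m. map_matrix id (transpose A) = - A}"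
      by (simp add: so_alg_def map_matrix_def vec_eq_iff)
    ultimately show ?thesis by simp
  qed
  moreover have "lie_isomorphic ?C (u_alg :: (complex^'m^'m) set)" if "r mod 8 = 2 \<or> r mod 8 = 6"
  proof -
    have "2 * (r div 2) = r - 1 + 1" using that by presburger
    then have "dim ?K = 2" using dim[of "r div 2" 1] that by (auto simp: spin_dim_def)
    then obtain h where "star_embedding cnj h" "range h = ?K"
      by (rule complex_embedding)
    then show ?thesis
      unfolding centralizer_spin_hat u_alg_def by (rule lie_isomorphic_skew_blocks)
  qed
  moreover have "lie_isomorphic ?C (sp_alg :: (quat^'m^'m) set)" if "r mod 8 = 3 \<or> r mod 8 = 5"
  proof -
    \<comment> \<open>The doubled representation dimension in these classes adds 2 to the exponent,
      which raises the commutant from dimension 1 to 4.\<close>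
    have "2 * (r div 2 + 1) = r - 1 + 2" using that by presburger
    then have "dim ?K = 4" using dim[of "r div 2 + 1" 2] that by (auto simp: spin_dim_def)
    then obtain h where "star_embedding qcnj h" "range h = ?K"
      by (rule quat_embedding)
    then show ?thesis
      unfolding centralizer_spin_hat sp_alg_def by (rule lie_isomorphic_skew_blocks)
  qed
  ultimately show ?thesis by (simp add: Let_def)
qed

end
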